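(* Let $\mathcal{T}_a$ and $\mathcal{T}_{a,j}$ ($a\in(-1,0)\cup(0,\infty)$, $j\in\mathbb{N}=\{0,1,2,\dots\}$) be the sets defined in the context. For every $a\in(-1,0)\cup(0,\infty)$ one has $\mathcal{T}_{a}=\bigcup_{j=0}^{\infty}\mathcal{T}_{a,j}$. Moreover: (i) $\mathcal{T}_{a,0}=\{T_{a,k}\}_{k=0}^{\infty}$ with $T_{a,k}\in\big(k\tau_{a},\big(k+\frac12\big)\tau_{a}\big)$ for every $k\in\mathbb{N}$. (ii) If $a<0$, then $\mathcal{T}_{a,j}=\varnothing$ for every $j\ge 1$ and $\mathcal{T}_{a}=\mathcal{T}_{a,0}$. (iii) If $a>0$, then $\mathcal{T}_{a,1}=\big\{(k+\frac12)\tau_{a}\big\}_{k=0}^{\infty}$ and $\mathcal{T}_{a,0}\cap\mathcal{T}_{a,1}=\varnothing$. (iv) If $a\in\big(0,\frac12(\sqrt3-1)\big]$, then $\mathcal{T}_{a,j}=\varnothing$ for every $j\ge 2$ and $\mathcal{T}_{a}=\mathcal{T}_{a,0}\cup\mathcal{T}_{a,1}$. (v) For every $j\geq2$ there exists $a^*_j>0$ such that $\mathcal{T}_{a,j}\neq\varnothing$ for $a\geq a^*_j$.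
   Context: For $a\in(-1,0)\cup(0,\infty)$ put $\gamma_a:=a(1+a)$ and let $(x_a,z_a)$ be the solution on $\mathbb{R}$ of $x''=(1+2\gamma_a)x-2x^3$, $z'=x^2-\gamma_a$, $x(0)=1+a$, $x'(0)=0$, $z(0)=0$. The function $x_a$ is even, positive and periodic of some period $2\tau_a$, and $x_a=\sqrt{(x_a')^2+(z_a')^2}$. Explicitly, with $K(m)=\int_0^{\pi/2}(1-m\sin^2\theta)^{-1/2}\,d\theta$, one has $\tau_a=\frac{1}{1+a}K\big(1-\frac{a^2}{(1+a)^2}\big)$ if $a\in(-\frac12,0)\cup(0,\infty)$ and $\tau_a=\frac{1}{|a|}K\big(1-\frac{(1+a)^2}{a^2}\big)$ if $a\in(-1,-\frac12)$ (for $a=-\frac12$, $x_a$ is constant). Let $\mathbb{S}^1=\mathbb{R}/2\pi\mathbb{Z}$ and $X_a(t,\theta)=(x_a(t)\cos\theta,x_a(t)\sin\theta,z_a(t))$ (a Delaunay surface of constant mean curvature $1$), with Gauss map $N_a=\frac{\partial_tX_a\wedge\partial_\theta X_a}{|\partial_tX_a\wedge\partial_\theta X_a|}$, where $\wedge$ is the cross product in $\mathbb{R}^3$. For a regular parametrized surface $X(t,\theta)$ with normal $N=\frac{X_t\wedge X_\theta}{|X_t\wedge X_\theta|}$ the mean curvature is $\mathfrak{M}(X)=\frac{\mathcal{E}\mathcal{N}-2\mathcal{F}\mathcal{M}+\mathcal{G}\mathcal{L}}{2(\mathcal{E}\mathcal{G}-\mathcal{F}^2)}$, with $\mathcal{E}=|X_t|^2$,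 $\mathcal{F}=X_t\cdot X_\theta$, $\mathcal{G}=|X_\theta|^2$, $\mathcal{L}=X_{tt}\cdot N$, $\mathcal{M}=X_{t\theta}\cdot N$, $\mathcal{N}=X_{\theta\theta}\cdot N$. The Jacobi operator is $\mathfrak{L}_a\varphi:=\frac{\partial}{\partial s}[\mathfrak{M}(X_a+s\varphi N_a)]\big|_{s=0}$; explicitly $\mathfrak{L}_a\varphi=\frac{1}{2x_a^2}(\varphi_{tt}+\varphi_{\theta\theta}+2p_a\varphi)$ with $p_a=x_a^2+\gamma_a^2/x_a^2$. Fix $\alpha\in(0,1)$. For $T>0$, $\mathcal{X}_T:=\{\varphi\in C^{2,\alpha}([-T,T]\times\mathbb{S}^1,\mathbb{R})\mid\varphi(\pm T,\cdot)=0,\ \varphi(t,\cdot)=\varphi(-t,\cdot)\ \forall t\in[-T,T]\}$. $\mathcal{T}_a$ is the set of $T>0$ for which there is a nontrivial $\varphi\in\mathcal{X}_T$ with $\mathfrak{L}_a\varphi=0$ in $[-T,T]\times\mathbb{S}^1$. $\mathcal{T}_{a,j}$ is the set of $T>0$ for which there is $\varphi\in C^2(\mathbb{R}\times\mathbb{S}^1)\setminus\{0\}$ of the form $\varphi(t,\theta)=w(t)\cos(j\theta)$ with $w$ even, such that $\mathfrak{L}_a\varphi=0$ on $\mathbb{R}\times\mathbb{S}^1$ and $\varphi(T,\cdot)=0$.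
   Formalization: In (i), the localization of T_{a,k} is asserted only for a ≠ -1/2; at a = -1/2 one has T_{a,0} = {(k+1/2)π}, which satisfies it for no value of τ_a, and only an increasing enumeration of T_{a,0} is claimed there. *)

theory Defs
  imports "HOL-Analysis.Analysis"
begin

section \<open>Delaunay profiles\<close>

definition gam :: "real \<Rightarrow> real" where
  "gam a = a * (1 + a)"

definition delaunay_ivp :: "real \<Rightarrow> (real \<Rightarrow> real) \<Rightarrow> (real \<Rightarrow> real) \<Rightarrow> bool" where
  "delaunay_ivp a x z \<longleftrightarrow> (\<exists>x'.
     (\<forall>t. (x has_real_derivative x' t) (at t)) \<and>
     (\<forall>t. (x' has_real_derivative ((1 + 2 * gam a) * x t - 2 * x t ^ 3)) (at t)) \<and>
     (\<forall>t. (z has_real_derivative ((x t)\<^sup>2 - gam a)) (at t)) \<and>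
     x 0 = 1 + a \<and> x' 0 = 0 \<and> z 0 = 0)"

definition delaunay :: "real \<Rightarrow> (real \<Rightarrow> real) \<times> (real \<Rightarrow> real)" where
  "delaunay a = (THE xz. delaunay_ivp a (fst xz) (snd xz))"

definition delaunay_x :: "real \<Rightarrow> real \<Rightarrow> real" where
  "delaunay_x a = fst (delaunay a)"

definition delaunay_z :: "real \<Rightarrow> real \<Rightarrow> real" where
  "delaunay_z a = snd (delaunay a)"

definition ellK :: "real \<Rightarrow> real" where
  "ellK m = integral {0..pi/2} (\<lambda>\<theta>. 1 / sqrt (1 - m * (sin \<theta>)\<^sup>2))"

text \<open>Half the period of \<^term>\<open>delaunay_x a\<close>. For \<^prop>\<open>a = -1/2\<close>
  the profile is constant and the number below (namely \<^term>\<open>pi\<close>) has no meaning.\<close>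

definition delaunay_tau :: "real \<Rightarrow> real" where
  "delaunay_tau a =
     (if a > -1/2 then 1 / (1 + a) * ellK (1 - a\<^sup>2 / (1 + a)\<^sup>2)
      else 1 / \<bar>a\<bar> * ellK (1 - (1 + a)\<^sup>2 / a\<^sup>2))"

section \<open>Mean curvature and the Jacobi operator\<close>

text \<open>Surfaces and functions on \<open>I \<times> S\<^sup>1\<close> are functions of \<open>t\<close> and \<open>\<theta>\<close>, where
  \<open>I\<close> is an interval; functions on \<open>S\<^sup>1\<close> are \<open>2\<pi>\<close>-periodic functions on the reals.
  Derivatives in \<open>t\<close> are taken within \<open>I\<close>: they are one-sided at the endpoints of a compact
  \<open>I\<close>, and values outside \<open>I\<close> play no role.\<close>

definition partial_t :: "real set \<Rightarrow> (real \<Rightarrow> real \<Rightarrow> 'a::real_normed_vector) \<Rightarrow> real \<Rightarrow> real \<Rightarrow> 'a" where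
  "partial_t I X t \<theta> = vector_derivative (\<lambda>s. X s \<theta>) (at t within I)"

definition partial_th :: "(real \<Rightarrow> real \<Rightarrow> 'a::real_normed_vector) \<Rightarrow> real \<Rightarrow> real \<Rightarrow> 'a" where
  "partial_th X t \<theta> = vector_derivative (\<lambda>r. X t r) (at \<theta>)"

definition unit_normal :: "real set \<Rightarrow> (real \<Rightarrow> real \<Rightarrow> real^3) \<Rightarrow> real \<Rightarrow> real \<Rightarrow> real^3" where
  "unit_normal I X t \<theta> =
     (let v = cross3 (partial_t I X t \<theta>) (partial_th X t \<theta>) in (1 / norm v) *\<^sub>R v)"

definition mean_curv :: "real set \<Rightarrow> (real \<Rightarrow> real \<Rightarrow> real^3) \<Rightarrow> real \<Rightarrow> real \<Rightarrow> real" where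
  "mean_curv I X t \<theta> =
     (let Xt = partial_t I X t \<theta>; Xh = partial_th X t \<theta>;
          nu = unit_normal I X t \<theta>;
          E = (norm Xt)\<^sup>2; F = Xt \<bullet> Xh; G = (norm Xh)\<^sup>2;
          L = partial_t I (partial_t I X) t \<theta> \<bullet> nu;
          M = partial_th (partial_t I X) t \<theta> \<bullet> nu;
          N = partial_th (partial_th X) t \<theta> \<bullet> nu
      in (E * N - 2 * F * M + G * L) / (2 * (E * G - F\<^sup>2)))"

definition delaunay_surf :: "real \<Rightarrow> real \<Rightarrow> real \<Rightarrow> real^3" where
  "delaunay_surf a t \<theta> =
     vector [delaunay_x a t * cos \<theta>, delaunay_x a t * sin \<theta>, delaunay_z a t]"

definition jacobi_op :: "real \<Rightarrow> real set \<Rightarrow> (real \<Rightarrow> real \<Rightarrow> real) \<Rightarrow> real \<Rightarrow> real \<Rightarrow> real" where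
  "jacobi_op a I \<phi> t \<theta> =
     deriv (\<lambda>s. mean_curv I
        (\<lambda>t \<theta>. delaunay_surf a t \<theta> + (s * \<phi> t \<theta>) *\<^sub>R unit_normal UNIV (delaunay_surf a) t \<theta>) t \<theta>) 0"

section \<open>Function spaces\<close>

definition has_gradient_on ::
  "(real \<times> real) set \<Rightarrow> (real \<times> real \<Rightarrow> real) \<Rightarrow> (real \<times> real \<Rightarrow> real) \<Rightarrow> (real \<times> real \<Rightarrow> real) \<Rightarrow> bool" where
  "has_gradient_on S f f1 f2 \<longleftrightarrow>
     (\<forall>p\<in>S. (f has_derivative (\<lambda>h. f1 p * fst h + f2 p * snd h)) (at p within S))"

text \<open>\<open>f\<close> is twice differentiable on \<open>S\<close> and all its second-order partial derivatives
  satisfy \<open>P\<close>.\<close>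

definition second_derivs_on ::
  "(real \<times> real) set \<Rightarrow> ((real \<times> real \<Rightarrow> real) \<Rightarrow> bool) \<Rightarrow> (real \<times> real \<Rightarrow> real) \<Rightarrow> bool" where
  "second_derivs_on S P f \<longleftrightarrow> (\<exists>f1 f2 f11 f12 f21 f22.
     has_gradient_on S f f1 f2 \<and> has_gradient_on S f1 f11 f12 \<and> has_gradient_on S f2 f21 f22 \<and>
     P f11 \<and> P f12 \<and> P f21 \<and> P f22)"

definition holder_on :: "real \<Rightarrow> (real \<times> real) set \<Rightarrow> (real \<times> real \<Rightarrow> real) \<Rightarrow> bool" where
  "holder_on \<alpha> S f \<longleftrightarrow> (\<exists>C. \<forall>p\<in>S. \<forall>q\<in>S. \<bar>f p - f q\<bar> \<le> C * dist p q powr \<alpha>)"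

definition C2_cyl :: "real set \<Rightarrow> (real \<Rightarrow> real \<Rightarrow> real) \<Rightarrow> bool" where
  "C2_cyl I \<phi> \<longleftrightarrow> (\<forall>t\<in>I. \<forall>\<theta>. \<phi> t (\<theta> + 2 * pi) = \<phi> t \<theta>) \<and>
     second_derivs_on (I \<times> UNIV) (continuous_on (I \<times> UNIV)) (\<lambda>(t, \<theta>). \<phi> t \<theta>)"

text \<open>For compact \<open>I\<close>: by periodicity, the Hoelder condition on the strip \<open>I \<times> UNIV\<close> is the
  one on \<open>I \<times> S\<^sup>1\<close>, and it implies continuity.\<close>

definition C2_holder_cyl :: "real \<Rightarrow> real set \<Rightarrow> (real \<Rightarrow> real \<Rightarrow> real) \<Rightarrow> bool" where
  "C2_holder_cyl \<alpha> I \<phi> \<longleftrightarrow> (\<forall>t\<in>I. \<forall>\<theta>. \<phi> t (\<theta> + 2 * pi) = \<phi> t \<theta>) \<and>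
     second_derivs_on (I \<times> UNIV) (holder_on \<alpha> (I \<times> UNIV)) (\<lambda>(t, \<theta>). \<phi> t \<theta>)"

definition space_X :: "real \<Rightarrow> real \<Rightarrow> (real \<Rightarrow> real \<Rightarrow> real) set" where
  "space_X \<alpha> T = {\<phi>. C2_holder_cyl \<alpha> {-T..T} \<phi> \<and>
     (\<forall>\<theta>. \<phi> T \<theta> = 0 \<and> \<phi> (-T) \<theta> = 0) \<and>
     (\<forall>t\<in>{-T..T}. \<forall>\<theta>. \<phi> t \<theta> = \<phi> (-t) \<theta>)}"

section \<open>Degenerate parameters\<close>

definition degen :: "real \<Rightarrow> real \<Rightarrow> real set" where
  "degen \<alpha> a = {T. T > 0 \<and> (\<exists>\<phi>\<in>space_X \<alpha> T.
     (\<exists>t\<in>{-T..T}. \<exists>\<theta>. \<phi> t \<theta> \<noteq> 0) \<and>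
     (\<forall>t\<in>{-T..T}. \<forall>\<theta>. jacobi_op a {-T..T} \<phi> t \<theta> = 0))}"

definition degen_mode :: "real \<Rightarrow> nat \<Rightarrow> real set" where
  "degen_mode a j = {T. T > 0 \<and> (\<exists>\<phi> w.
     C2_cyl UNIV \<phi> \<and> (\<exists>t \<theta>. \<phi> t \<theta> \<noteq> 0) \<and>
     (\<forall>t \<theta>. \<phi> t \<theta> = w t * cos (real j * \<theta>)) \<and> (\<forall>t. w (-t) = w t) \<and>
     (\<forall>t \<theta>. jacobi_op a UNIV \<phi> t \<theta> = 0) \<and>
     (\<forall>\<theta>. \<phi> T \<theta> = 0))}"

end

(* The substitution x = phi', phi'^2 = (1+a)^2 cos^2 phi + a^2 sin^2 phi, solves the profile equation
   for every a at once.  With b = 1 + 2a, the function sn = sin phi cos phi / x satisfies x'/x = -b sn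
   and p = c - b^2 sn^2 with 2c = 1 + b^2, so that the j-th mode obeys the Lame equation
   w'' = (j^2 - 1 - b^2 + 2 b^2 sn^2) w.  Explicit solutions are sn (j = 0, odd),
   sn' - b^2 sn int sn^2 (j = 0, even), dn = x - gamma/x (j = 1, even) and kap = x + gamma/x
   (j^2 = b^2, even).  The first two settle j = 0, the zeros of dn settle j = 1 for a > 0, and Sturm
   comparison with dn (a < 0) or kap (a > 0) settles the other modes: for a > 0 the even solution
   has a zero if j < b and none if j >= b.  The decomposition of the degenerate set is Fourier
   expansion in the angle. *)

theory Submission
  imports Defs
begin

section \<open>Second-order equations\<close>

text \<open>\<open>sn\<close>, \<open>dn\<close> and \<open>kap\<close> are Jacobi's sn, dn and b cn
  of modulus \<open>b\<close>, the band-edge functions of the mode equation. Since |b| < 1 for a < 0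
  and b > 1 for a > 0, dn and cn exchange roles at a = 0: the one without zeros is \<open>dn\<close>
  (eigenvalue 1) for a < 0 and \<open>kap\<close> (eigenvalue b^2) for a > 0. Hence the comparison
  function changes with the sign of a. The explicit solutions have a geometric origin. Translation
  along the axis gives \<open>sn\<close> up to the factor -b, sideways translation gives
  \<open>dn\<close>, and variation of the parameter a gives the even solution for j = 0;
  \<open>kap\<close> comes from no such motion. At a = -1/2 one has b = 0: the profile is constant,
  \<open>sn\<close> is sin, the even solution for j = 0 is cos, and its zeros are the right
  endpoints (k + 1/2) tau. The identities are therefore kept free of division by \<open>b\<close>,
  and strict bounds are claimed only for nonzero \<open>b\<close>. Elements of
  \<open>space_X\<close> live on [-T,T], modes on the whole line. The bridge is uniqueness for
  linear equations with derivatives taken within a compact interval.\<close>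

lemma continuous_on_Icc_bounded:
  fixes h :: "real \<Rightarrow> real"
  assumes "continuous_on {a..b} h"
  obtains M where "\<And>t. t \<in> {a..b} \<Longrightarrow> \<bar>h t\<bar> \<le> M"
proof -
  have "bounded (h ` {a..b})"
    using assms by (intro compact_imp_bounded compact_continuous_image) auto
  then show thesis
    using that unfolding bounded_iff by (metis imageI real_norm_def)
qed

text \<open>Gronwall as a monotonicity statement: since |2 (1 + h) w v| is at most (1 + M) (w^2 +
  v^2), the energy w^2 + v^2 with the weight exp (- (1 + M) t) cannot increase, and it starts at 0.
  Derivatives are asked for only in the open interval, so that one-sided data at the endpoints
  suffice.\<close>

lemma linear_ode_zero_right:
  fixes w v h :: "real \<Rightarrow> real"
  assumes w: "\<And>t. t \<in> {0<..<T} \<Longrightarrow> (w has_real_derivative v t) (at t)"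
    and v: "\<And>t. t \<in> {0<..<T} \<Longrightarrow> (v has_real_derivative h t * w t) (at t)"
    and cw: "continuous_on {0..T} w" and cv: "continuous_on {0..T} v"
    and h: "continuous_on {0..T} h"
    and 0: "w 0 = 0" "v 0 = 0" and t: "t \<in> {0..T}"
  shows "w t = 0"
proof -
  obtain M where M: "\<And>t. t \<in> {0..T} \<Longrightarrow> \<bar>h t\<bar> \<le> M"
    using continuous_on_Icc_bounded[OF h] by blast
  define E where "E t = exp (- (1 + M) * t) * ((w t)\<^sup>2 + (v t)\<^sup>2)" for t
  have "E t \<le> E 0"
  proof (rule DERIV_nonpos_imp_decreasing_open[where f=E])
    show "0 \<le> t" using t by simp
    show "continuous_on {0..t} E"
      unfolding E_def using t
      by (intro continuous_intros continuous_on_subset[OF cw] continuous_on_subset[OF cv]) auto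
  next
    fix r assume r: "0 < r" "r < t"
    then have rT: "r \<in> {0<..<T}" using t by auto
    let ?D = "exp (- (1 + M) * r) *
      (2 * (1 + h r) * (w r * v r) - (1 + M) * ((w r)\<^sup>2 + (v r)\<^sup>2))"
    have "(E has_real_derivative ?D) (at r)"
      unfolding E_def
      by (rule derivative_eq_intros w[OF rT] v[OF rT] refl)+
         (simp add: algebra_simps power2_eq_square)
    moreover have "?D \<le> 0"
    proof -
      have m: "\<bar>1 + h r\<bar> \<le> 1 + M" using M[of r] rT by auto
      have "\<bar>2 * (w r * v r)\<bar> \<le> (w r)\<^sup>2 + (v r)\<^sup>2"
        using sum_squares_bound[of "w r" "v r"] sum_squares_bound[of "w r" "- v r"]
        by (auto simp: abs_if mult.assoc)
      then have "\<bar>(1 + h r) * (2 * (w r * v r))\<bar> \<le> (1 + M) * ((w r)\<^sup>2 + (v r)\<^sup>2)"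
        unfolding abs_mult[of "1 + h r"] using m by (intro mult_mono) auto
      then have "(1 + h r) * (2 * (w r * v r)) \<le> (1 + M) * ((w r)\<^sup>2 + (v r)\<^sup>2)"
        by linarith
      then have "2 * (1 + h r) * (w r * v r) - (1 + M) * ((w r)\<^sup>2 + (v r)\<^sup>2) \<le> 0"
        by (simp add: algebra_simps)
      then show ?thesis by (simp add: mult_le_0_iff)
    qed
    ultimately show "\<exists>y. (E has_real_derivative y) (at r) \<and> y \<le> 0" by blast
  qed
  then have "(w t)\<^sup>2 + (v t)\<^sup>2 \<le> 0"
    unfolding E_def using 0 by (simp add: mult_le_0_iff)
  then show ?thesis by (simp add: sum_power2_le_zero_iff)
qed

text \<open>Negative times reduce to positive ones by t -> -t, under which \<open>v\<close> changes
  sign and \<open>h\<close> is reflected. Derivatives within the closed interval are what functions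
  in \<open>space_X\<close> supply.\<close>

lemma linear_ode_zero:
  fixes w v h :: "real \<Rightarrow> real"
  assumes w: "\<And>t. t \<in> {-T..T} \<Longrightarrow> (w has_real_derivative v t) (at t within {-T..T})"
    and v: "\<And>t. t \<in> {-T..T} \<Longrightarrow> (v has_real_derivative h t * w t) (at t within {-T..T})"
    and h: "continuous_on {-T..T} h"
    and 0: "w 0 = 0" "v 0 = 0" and t: "t \<in> {-T..T}"
  shows "w t = 0"
proof -
  have at: "at r within {-T..T} = at r" if "r \<in> {-T<..<T}" for r
    using that by (intro at_within_Icc_at) auto
  have cw: "continuous_on {-T..T} w" and cv: "continuous_on {-T..T} v"
    using DERIV_continuous_on[OF w] DERIV_continuous_on[OF v] by auto
  have m: "continuous_on {0..T} (\<lambda>r. f (- r))" if "continuous_on {-T..T} f" for f :: "real \<Rightarrow> real"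
    by (rule continuous_on_compose2[OF that]) (auto intro!: continuous_intros)
  show ?thesis
  proof (cases "t \<ge> 0")
    case True
    show ?thesis
    proof (rule linear_ode_zero_right[of T w v h])
      fix r assume "r \<in> {0<..<T}"
      then have r: "r \<in> {-T..T}" "r \<in> {-T<..<T}" by auto
      show "(w has_real_derivative v r) (at r)" "(v has_real_derivative h r * w r) (at r)"
        using w[OF r(1)] v[OF r(1)] at[OF r(2)] by simp_all
    qed (use 0 True t in \<open>auto intro: continuous_on_subset[OF cw]
            continuous_on_subset[OF cv] continuous_on_subset[OF h]\<close>)
  next
    case False
    have "w (- (- t)) = 0"
    proof (rule linear_ode_zero_right[of T "\<lambda>r. w (- r)" "\<lambda>r. - v (- r)" "\<lambda>r. h (- r)"])
      fix r assume r: "r \<in> {0<..<T}"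
      then have r': "- r \<in> {-T..T}" "- r \<in> {-T<..<T}" by auto
      have dw: "(w has_real_derivative v (-r)) (at (-r))"
        and dv: "(v has_real_derivative h (-r) * w (-r)) (at (-r))"
        using w[OF r'(1)] v[OF r'(1)] at[OF r'(2)] by auto
      show "((\<lambda>r. w (- r)) has_real_derivative - v (- r)) (at r)"
        using dw by (simp add: DERIV_mirror)
      show "((\<lambda>r. - v (- r)) has_real_derivative h (- r) * w (- r)) (at r)"
        using DERIV_minus[OF dv[unfolded DERIV_mirror]] by simp
    qed (use 0 t False in \<open>auto intro!: m cw cv h continuous_intros\<close>)
    then show ?thesis by simp
  qed
qed

lemma linear_ode_unique:
  fixes w v h :: "real \<Rightarrow> real"
  assumes w: "\<And>t. t \<in> {-T..T} \<Longrightarrow> (w has_real_derivative v t) (at t within {-T..T})"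
    and v: "\<And>t. t \<in> {-T..T} \<Longrightarrow> (v has_real_derivative h t * w t) (at t within {-T..T})"
    and w': "\<And>t. t \<in> {-T..T} \<Longrightarrow> (w' has_real_derivative v' t) (at t within {-T..T})"
    and v': "\<And>t. t \<in> {-T..T} \<Longrightarrow> (v' has_real_derivative h t * w' t) (at t within {-T..T})"
    and h: "continuous_on {-T..T} h"
    and 0: "w 0 = C * w' 0" "v 0 = C * v' 0" and t: "t \<in> {-T..T}"
  shows "w t = C * w' t"
proof -
  have "w t - C * w' t = 0"
  proof (rule linear_ode_zero[where w="\<lambda>t. w t - C * w' t" and v="\<lambda>t. v t - C * v' t" and h=h and T=T])
    fix t assume t: "t \<in> {-T..T}"
    show "((\<lambda>t. w t - C * w' t) has_real_derivative v t - C * v' t) (at t within {-T..T})"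
      by (rule derivative_eq_intros w[OF t] w'[OF t] refl | simp)+
    show "((\<lambda>t. v t - C * v' t) has_real_derivative h t * (w t - C * w' t)) (at t within {-T..T})"
      by (rule derivative_eq_intros v[OF t] v'[OF t] refl | simp add: algebra_simps)+
  qed (use 0 h t in auto)
  then show ?thesis by simp
qed

lemma linear_ode_zero_global:
  fixes w v h :: "real \<Rightarrow> real"
  assumes w: "\<And>t. (w has_real_derivative v t) (at t)"
    and v: "\<And>t. (v has_real_derivative h t * w t) (at t)"
    and h: "continuous_on UNIV h"
    and 0: "w 0 = 0" "v 0 = 0"
  shows "w t = 0"
  by (rule linear_ode_zero[of "\<bar>t\<bar>" w v h])
     (use assms in \<open>auto intro: has_field_derivative_at_within continuous_on_subset\<close>)

text \<open>The difference of two solutions of \<open>x'' = A x + B x\<^sup>3\<close> solves a linear equation.\<close>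

lemma cubic_ode_unique:
  fixes x y u v :: "real \<Rightarrow> real"
  assumes x: "\<And>t. (x has_real_derivative u t) (at t)"
    and u: "\<And>t. (u has_real_derivative A * x t + B * x t ^ 3) (at t)"
    and y: "\<And>t. (y has_real_derivative v t) (at t)"
    and v: "\<And>t. (v has_real_derivative A * y t + B * y t ^ 3) (at t)"
    and 0: "x 0 = y 0" "u 0 = v 0"
  shows "x = y"
proof
  fix t
  define h where "h t = A + B * ((x t)\<^sup>2 + x t * y t + (y t)\<^sup>2)" for t
  have "continuous_on UNIV x" "continuous_on UNIV y"
    using x y by (auto intro!: DERIV_continuous_on)
  then have h: "continuous_on UNIV h"
    unfolding h_def by (intro continuous_intros)
  have "x t - y t = 0"
  proof (rule linear_ode_zero_global[where w="\<lambda>t. x t - y t" and v="\<lambda>t. u t - v t" and h=h])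
    fix t
    show "((\<lambda>t. x t - y t) has_real_derivative u t - v t) (at t)"
      by (rule derivative_eq_intros x y refl)+
    show "((\<lambda>t. u t - v t) has_real_derivative h t * (x t - y t)) (at t)"
      by (rule derivative_eq_intros u v refl)+
         (simp add: h_def algebra_simps power2_eq_square power3_eq_cube)
  qed (use h 0 in auto)
  then show "x t = y t" by simp
qed

section \<open>Global existence for linear second-order equations\<close>

definition primitive :: "(real \<Rightarrow> real) \<Rightarrow> real \<Rightarrow> real" where
  "primitive f = (SOME F. F 0 = 0 \<and> (\<forall>t. (F has_real_derivative f t) (at t)))"

lemma primitive:
  assumes "continuous_on UNIV f"
  shows "primitive f 0 = 0" and "(primitive f has_real_derivative f t) (at t)"
proof -
  have "\<And>x. isCont f x"
    using assms by (simp add: continuous_on_eq_continuous_at)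
  then obtain F where F: "\<And>x. (F has_vector_derivative f x) (at x)"
    using einterval_antiderivative[of "-\<infinity>" "\<infinity>" f] by auto
  have "\<exists>F. F 0 = 0 \<and> (\<forall>t. (F has_real_derivative f t) (at t))"
    by (intro exI[of _ "\<lambda>t. F t - F 0"])
       (use F in \<open>auto simp: has_real_derivative_iff_has_vector_derivative
          intro!: derivative_eq_intros\<close>)
  then have "primitive f 0 = 0 \<and> (\<forall>t. (primitive f has_real_derivative f t) (at t))"
    unfolding primitive_def by (rule someI_ex)
  then show "primitive f 0 = 0" "(primitive f has_real_derivative f t) (at t)" by auto
qed

lemma continuous_on_primitive:
  assumes "continuous_on UNIV f"
  shows "continuous_on A (primitive f)"
  by (rule DERIV_continuous_on[OF has_field_derivative_at_within[OF primitive(2)[OF assms]]])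

text \<open>Compare derivatives: with G = K t^(m+1) / (m+1)!, both G - F and G + F are nondecreasing
  and vanish at 0. Iterating this gives the factorial decay of the Picard terms.\<close>

lemma power_fact_bound_right:
  fixes F f :: "real \<Rightarrow> real"
  assumes "\<And>t. (F has_real_derivative f t) (at t)" and "F 0 = 0"
    and "\<And>t. t \<in> {0..R} \<Longrightarrow> \<bar>f t\<bar> \<le> K * t ^ m / fact m" and t: "t \<in> {0..R}"
  shows "\<bar>F t\<bar> \<le> K * t ^ Suc m / fact (Suc m)"
proof -
  define G where "G t = K * t ^ Suc m / fact (Suc m)" for t
  have dG: "(G has_real_derivative K * t ^ m / fact m) (at t)" for t
    unfolding G_def fact_Suc
    by (rule derivative_eq_intros refl | simp)+
  have G0: "G 0 = 0" by (simp add: G_def)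
  have t0: "0 \<le> t" using t by simp
  have "G 0 - F 0 \<le> G t - F t"
  proof (rule DERIV_nonneg_imp_nondecreasing[OF t0])
    fix r assume "0 \<le> r" "r \<le> t"
    then have "\<bar>f r\<bar> \<le> K * r ^ m / fact m" using assms(3)[of r] t by simp
    then show "\<exists>y. ((\<lambda>t. G t - F t) has_real_derivative y) (at r) \<and> 0 \<le> y"
      by (intro exI[of _ "K * r ^ m / fact m - f r"] conjI DERIV_diff[OF dG assms(1)])
         (simp add: abs_le_iff)
  qed
  moreover have "G 0 + F 0 \<le> G t + F t"
  proof (rule DERIV_nonneg_imp_nondecreasing[OF t0])
    fix r assume "0 \<le> r" "r \<le> t"
    then have "\<bar>f r\<bar> \<le> K * r ^ m / fact m" using assms(3)[of r] t by simp
    then show "\<exists>y. ((\<lambda>t. G t + F t) has_real_derivative y) (at r) \<and> 0 \<le> y"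
      by (intro exI[of _ "K * r ^ m / fact m + f r"] conjI DERIV_add[OF dG assms(1)])
         (simp add: abs_le_iff)
  qed
  ultimately show ?thesis
    using G0 assms(2) by (simp add: G_def abs_le_iff)
qed

lemma power_fact_bound:
  fixes F f :: "real \<Rightarrow> real"
  assumes F: "\<And>t. (F has_real_derivative f t) (at t)" and 0: "F 0 = 0"
    and f: "\<And>t. \<bar>t\<bar> \<le> R \<Longrightarrow> \<bar>f t\<bar> \<le> K * \<bar>t\<bar> ^ m / fact m" and t: "\<bar>t\<bar> \<le> R"
  shows "\<bar>F t\<bar> \<le> K * \<bar>t\<bar> ^ Suc m / fact (Suc m)"
proof (cases "t \<ge> 0")
  case True
  have "\<bar>F t\<bar> \<le> K * t ^ Suc m / fact (Suc m)"
  proof (rule power_fact_bound_right[OF F 0])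
    show "\<bar>f r\<bar> \<le> K * r ^ m / fact m" if "r \<in> {0..R}" for r
      using f[of r] that by simp
  qed (use t True in auto)
  then show ?thesis using True by simp
next
  case False
  have d: "((\<lambda>t. F (- t)) has_real_derivative - f (- t)) (at t)" for t
    using F[of "- t"] by (simp add: DERIV_mirror)
  have "\<bar>F (- (- t))\<bar> \<le> K * (- t) ^ Suc m / fact (Suc m)"
  proof (rule power_fact_bound_right[OF d])
    show "\<bar>- f (- r)\<bar> \<le> K * r ^ m / fact m" if "r \<in> {0..R}" for r
      using f[of "- r"] that by simp
  qed (use 0 t False in auto)
  then show ?thesis using False by simp
qed

context
  fixes h :: "real \<Rightarrow> real"
begin

text \<open>The terms f_n of a formal solution: f_0 = 1 and f_(n+1)'' = h f_n with zero initial
  data, so their sum satisfies w'' = h w, w(0) = 1, w'(0) = 0.\<close>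

fun picard_term :: "nat \<Rightarrow> real \<Rightarrow> real" where
  "picard_term 0 = (\<lambda>t. 1)"
| "picard_term (Suc n) = primitive (primitive (\<lambda>t. h t * picard_term n t))"

end

text \<open>On |t| <= R the terms are dominated by M^n |t|^(2n) / (2n)!. The series of first and of
  second derivatives therefore converge uniformly on every compact interval, and the sum may be
  differentiated twice term by term on the whole line.\<close>

lemma linear_ode_exists:
  fixes h :: "real \<Rightarrow> real"
  assumes h: "continuous_on UNIV h"
  obtains w v where "\<And>t. (w has_real_derivative v t) (at t)"
    "\<And>t. (v has_real_derivative h t * w t) (at t)" "w 0 = 1" "v 0 = 0"
proof -
  define f where "f = picard_term h"
  define g where "g n = primitive (\<lambda>t. h t * f n t)" for n
  have f0: "f 0 = (\<lambda>t. 1)" and fS: "f (Suc n) = primitive (g n)" for n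
    by (simp_all add: f_def g_def)
  have cf: "continuous_on UNIV (f n)" for n
  proof (induction n)
    case (Suc n)
    then show ?case unfolding fS g_def using h
      by (intro continuous_on_primitive continuous_intros)
  qed (simp add: f0)
  have chf: "continuous_on UNIV (\<lambda>t. h t * f n t)" for n
    using h cf by (intro continuous_intros)
  have cg: "continuous_on UNIV (g n)" for n
    unfolding g_def using chf by (rule continuous_on_primitive)
  have dg: "(g n has_real_derivative h t * f n t) (at t)" and g0: "g n 0 = 0" for n t
    unfolding g_def using primitive[OF chf] by auto
  have df: "(f (Suc n) has_real_derivative g n t) (at t)" and fS0: "f (Suc n) 0 = 0" for n t
    unfolding fS using primitive[OF cg] by auto
  have bound: "\<exists>B. summable B \<and>
      (\<forall>n t. \<bar>t\<bar> \<le> R \<longrightarrow> \<bar>g n t\<bar> \<le> B n \<and> \<bar>h t * f n t\<bar> \<le> B n)" for R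
  proof -
    obtain M0 where M0: "\<And>t. t \<in> {-R..R} \<Longrightarrow> \<bar>h t\<bar> \<le> M0"
      using continuous_on_Icc_bounded[OF continuous_on_subset[OF h subset_UNIV]] by blast
    define M where "M = max 1 M0"
    have M: "\<bar>h t\<bar> \<le> M" if "\<bar>t\<bar> \<le> R" for t
      using M0[of t] that by (simp add: M_def abs_le_iff le_max_iff_disj)
    have M1: "M \<ge> 1" by (simp add: M_def)
    have fg: "(\<forall>t. \<bar>t\<bar> \<le> R \<longrightarrow> \<bar>h t * f n t\<bar> \<le> M ^ Suc n * \<bar>t\<bar> ^ (2*n) / fact (2*n)) \<and>
        (\<forall>t. \<bar>t\<bar> \<le> R \<longrightarrow> \<bar>g n t\<bar> \<le> M ^ Suc n * \<bar>t\<bar> ^ Suc (2*n) / fact (Suc (2*n)))" for n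
    proof (induction n)
      case 0
      have "\<forall>t. \<bar>t\<bar> \<le> R \<longrightarrow> \<bar>h t * f 0 t\<bar> \<le> M ^ Suc 0 * \<bar>t\<bar> ^ (2*0) / fact (2*0)"
        using M by (simp add: f0)
      then show ?case using power_fact_bound[OF dg g0] by blast
    next
      case (Suc n)
      have f: "\<bar>f (Suc n) t\<bar> \<le> M ^ Suc n * \<bar>t\<bar> ^ Suc (Suc (2*n)) / fact (Suc (Suc (2*n)))"
        if "\<bar>t\<bar> \<le> R" for t
        by (rule power_fact_bound[OF df fS0 _ that]) (use Suc in blast)
      have hf: "\<bar>h t * f (Suc n) t\<bar> \<le> M ^ Suc (Suc n) * \<bar>t\<bar> ^ (2 * Suc n) / fact (2 * Suc n)"
        if "\<bar>t\<bar> \<le> R" for t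
      proof -
        have "\<bar>h t\<bar> * \<bar>f (Suc n) t\<bar> \<le>
            M * (M ^ Suc n * \<bar>t\<bar> ^ Suc (Suc (2*n)) / fact (Suc (Suc (2*n))))"
          using M[OF that] f[OF that] M1 by (intro mult_mono) auto
        then show ?thesis by (simp add: abs_mult mult.assoc)
      qed
      then show ?case using power_fact_bound[OF dg g0] by blast
    qed
    \<comment> \<open>One summable majorant for both derivative series. Because \<open>M\<close> and
      |R| + 1 are at least 1, all exponents may be rounded up to 2n + 1, and the factorials are
      weakened to n!, which leaves an exponential series.\<close>
    define B where "B n = M*(\<bar>R\<bar>+1) * (((M*(\<bar>R\<bar>+1))\<^sup>2) ^ n / fact n)" for n :: nat
    have "summable (\<lambda>n. ((M*(\<bar>R\<bar>+1))\<^sup>2) ^ n / fact n)"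
      using summable_exp_generic[of "(M*(\<bar>R\<bar>+1))\<^sup>2"] by (simp add: divide_inverse mult.commute)
    then have "summable B" unfolding B_def by (rule summable_mult)
    moreover have "\<bar>g n t\<bar> \<le> B n \<and> \<bar>h t * f n t\<bar> \<le> B n" if t: "\<bar>t\<bar> \<le> R" for n t
    proof -
      have a: "M ^ Suc n \<le> M ^ Suc (2*n)" using M1 by (intro power_increasing) auto
      have b1: "\<bar>t\<bar> ^ Suc (2*n) \<le> (\<bar>R\<bar>+1) ^ Suc (2*n)"
        using t by (intro power_mono) auto
      have "\<bar>t\<bar> ^ (2*n) \<le> (\<bar>R\<bar>+1) ^ (2*n)"
        using t by (intro power_mono) auto
      also have "\<dots> \<le> (\<bar>R\<bar>+1) ^ Suc (2*n)" by (intro power_increasing) auto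
      finally have b2: "\<bar>t\<bar> ^ (2*n) \<le> (\<bar>R\<bar>+1) ^ Suc (2*n)" .
      have B: "B n = M ^ Suc (2*n) * (\<bar>R\<bar>+1) ^ Suc (2*n) / fact n"
        by (simp add: B_def power_mult_distrib power_mult[symmetric])
      have "M ^ Suc n * \<bar>t\<bar> ^ Suc (2*n) / fact (Suc (2*n)) \<le> B n"
        unfolding B using a b1 M1
        by (intro frac_le mult_mono fact_mono) (auto simp del: fact_Suc)
      moreover have "M ^ Suc n * \<bar>t\<bar> ^ (2*n) / fact (2*n) \<le> B n"
        unfolding B using a b2 M1
        by (intro frac_le mult_mono fact_mono) auto
      ultimately show ?thesis using fg[of n] t by (meson order_trans)
    qed
    ultimately show ?thesis by blast
  qed
  define w where "w t = 1 + (\<Sum>n. f (Suc n) t)" for t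
  define v where "v t = (\<Sum>n. g n t)" for t
  have main: "(w has_real_derivative v t) (at t) \<and> (v has_real_derivative h t * w t) (at t)" for t
  proof -
    define R where "R = \<bar>t\<bar> + 1"
    obtain B where B: "summable B"
      "\<And>n t. \<bar>t\<bar> \<le> R \<Longrightarrow> \<bar>g n t\<bar> \<le> B n \<and> \<bar>h t * f n t\<bar> \<le> B n"
      using bound[of R] by blast
    have int: "t \<in> interior {-R..R}" by (auto simp: R_def)
    have u1: "uniformly_convergent_on {-R..R} (\<lambda>n x. \<Sum>i<n. g i x)"
      by (rule Weierstrass_m_test'[OF _ B(1)]) (use B(2) in auto)
    have u2: "uniformly_convergent_on {-R..R} (\<lambda>n x. \<Sum>i<n. h x * f i x)"
      by (rule Weierstrass_m_test'[OF _ B(1)]) (use B(2) in auto)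
    note s1 = has_field_derivative_series'[OF convex_real_interval(5)
        has_field_derivative_at_within[OF df] u1 _ _ int, of 0]
    note s2 = has_field_derivative_series'[OF convex_real_interval(5)
        has_field_derivative_at_within[OF dg] u2 _ _ int, of 0]
    have z: "0 \<in> {-R..R}" by (auto simp: R_def)
    have sf: "summable (\<lambda>n. f (Suc n) t)"
      and dw: "((\<lambda>x. \<Sum>n. f (Suc n) x) has_real_derivative (\<Sum>n. g n t)) (at t)"
      using s1 z fS0 by auto
    have dv: "((\<lambda>x. \<Sum>n. g n x) has_real_derivative (\<Sum>n. h t * f n t)) (at t)"
      using s2 z g0 by auto
    have "summable (\<lambda>n. f n t)" using sf by (subst (asm) summable_Suc_iff)
    then have "(\<Sum>n. h t * f n t) = h t * (\<Sum>n. f n t)" by (rule suminf_mult)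
    also have "(\<Sum>n. f n t) = w t"
      using suminf_split_head[OF \<open>summable (\<lambda>n. f n t)\<close>] by (simp add: w_def f0)
    finally have "(\<Sum>n. h t * f n t) = h t * w t" .
    then show ?thesis using dw dv unfolding w_def[abs_def] v_def[abs_def]
      by (auto intro!: derivative_eq_intros)
  qed
  show thesis
    by (rule that[of w v]) (use main in \<open>auto simp: w_def v_def fS0 g0\<close>)
qed

section \<open>The Delaunay profile\<close>

locale delaunay_param =
  fixes a :: real
  assumes a_gt: "a > -1" and a_nz: "a \<noteq> 0"
begin

definition b :: real where "b = 1 + 2 * a"
definition c :: real where "c = 1 + 2 * gam a"

lemma c_eq: "2 * c = 1 + b\<^sup>2"
  by (simp add: c_def b_def gam_def power2_eq_square algebra_simps)

section \<open>The amplitude and the function \<open>sn\<close>\<close>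

definition speed2 :: "real \<Rightarrow> real" where
  "speed2 \<theta> = (1 + a)\<^sup>2 * (cos \<theta>)\<^sup>2 + a\<^sup>2 * (sin \<theta>)\<^sup>2"

lemma speed2_eq: "speed2 \<theta> = a\<^sup>2 + b * (cos \<theta>)\<^sup>2"
  unfolding speed2_def b_def sin_squared_eq by (simp add: algebra_simps power2_eq_square)

text \<open>The excluded values a = 0 and a = -1 are exactly those at which \<open>speed2\<close>
  would have zeros and the angle would need infinite time to reach them.\<close>

lemma speed2_pos: "speed2 \<theta> > 0"
proof (cases "cos \<theta> = 0")
  case True
  then have "(sin \<theta>)\<^sup>2 = 1" using sin_cos_squared_add[of \<theta>] by simp
  then show ?thesis using a_nz by (simp add: speed2_def True)
next
  case False
  then show ?thesis using a_gt
    by (auto simp: speed2_def intro!: add_pos_nonneg mult_pos_pos)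
qed

lemma continuous_speed: "continuous_on S (\<lambda>\<theta>. 1 / sqrt (speed2 \<theta>))"
proof -
  have "continuous_on S speed2"
    unfolding speed2_def[abs_def] by (intro continuous_intros)
  then show ?thesis
    using speed2_pos by (intro continuous_intros) (auto simp: less_imp_neq[symmetric])
qed

text \<open>An elliptic integral of the first kind: the time at which the angle \<theta> is reached.
  Its inverse \<open>amp\<close> is the angle phi of the substitution.\<close>

definition ellF :: "real \<Rightarrow> real" where
  "ellF = primitive (\<lambda>\<theta>. 1 / sqrt (speed2 \<theta>))"

lemma ellF_0: "ellF 0 = 0"
  and ellF_deriv: "(ellF has_real_derivative 1 / sqrt (speed2 \<theta>)) (at \<theta>)"
  unfolding ellF_def using primitive[OF continuous_speed] by auto

lemma ellF_strict_mono: "strict_mono ellF"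
proof (rule strict_monoI)
  fix u v :: real assume "u < v"
  then show "ellF u < ellF v"
    by (rule DERIV_pos_imp_increasing) (use ellF_deriv speed2_pos in \<open>fastforce\<close>)
qed

lemma isCont_ellF: "isCont ellF \<theta>"
  using ellF_deriv by (rule DERIV_isCont)

text \<open>The speed never exceeds \<open>K\<close>, so \<open>ellF\<close> has slope at least 1/K
  and is unbounded in both directions. Hence the angle, and with it the profile, is defined for all
  times.\<close>

lemma ellF_surj: "\<exists>\<theta>. ellF \<theta> = t"
proof -
  define K where "K = sqrt ((1 + a)\<^sup>2 + a\<^sup>2)"
  have K: "K > 0" using a_gt by (auto simp: K_def intro!: add_pos_nonneg)
  have "speed2 \<theta> \<le> (1 + a)\<^sup>2 + a\<^sup>2" for \<theta>
    unfolding speed2_def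
    by (intro add_mono mult_left_le) (auto simp: abs_square_le_1)
  then have "sqrt (speed2 \<theta>) \<le> K" for \<theta>
    unfolding K_def by simp
  then have lower: "1 / K \<le> 1 / sqrt (speed2 \<theta>)" for \<theta>
    using speed2_pos[of \<theta>] by (intro divide_left_mono) (auto simp: K)
  have mono: "ellF u - u / K \<le> ellF v - v / K" if "u \<le> v" for u v
  proof (rule DERIV_nonneg_imp_nondecreasing[OF that])
    fix r
    have "((\<lambda>u. ellF u - u / K) has_real_derivative 1 / sqrt (speed2 r) - 1 / K) (at r)"
      by (intro DERIV_diff ellF_deriv DERIV_cdivide[OF DERIV_ident])
    then show "\<exists>y. ((\<lambda>u. ellF u - u / K) has_real_derivative y) (at r) \<and> 0 \<le> y"
      using lower[of r] by (intro exI conjI) auto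
  qed
  have up: "\<bar>t\<bar> \<le> ellF (K * \<bar>t\<bar>)"
    using mono[of 0 "K * \<bar>t\<bar>"] K ellF_0 by simp
  have lo: "ellF (- (K * \<bar>t\<bar>)) \<le> - \<bar>t\<bar>"
    using mono[of "- (K * \<bar>t\<bar>)" 0] K ellF_0 by simp
  have "\<exists>\<theta>\<ge>- (K * \<bar>t\<bar>). \<theta> \<le> K * \<bar>t\<bar> \<and> ellF \<theta> = t"
    using up lo K by (intro IVT) (auto simp: isCont_ellF)
  then show ?thesis by blast
qed

definition amp :: "real \<Rightarrow> real" where "amp = inv ellF"

lemma ellF_amp: "ellF (amp t) = t"
  unfolding amp_def using ellF_surj by (metis surjI surj_f_inv_f)

lemma amp_ellF: "amp (ellF \<theta>) = \<theta>"
  using ellF_amp[of "ellF \<theta>"] strict_mono_eq[OF ellF_strict_mono] by simp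

lemma amp_0: "amp 0 = 0"
  using amp_ellF[of 0] ellF_0 by simp

definition prof :: "real \<Rightarrow> real" where "prof t = sqrt (speed2 (amp t))"

lemma prof_pos: "prof t > 0"
  unfolding prof_def using speed2_pos by simp

lemma prof_nz: "prof t \<noteq> 0"
  using prof_pos[of t] by simp

lemma prof_sq: "(prof t)\<^sup>2 = a\<^sup>2 + b * (cos (amp t))\<^sup>2"
  using speed2_pos[of "amp t"] by (simp add: prof_def speed2_eq)

lemma amp_deriv: "(amp has_real_derivative prof t) (at t)"
proof -
  have "isCont amp (ellF (amp t))"
    by (rule isCont_inverse_function[of 1]) (auto simp: amp_ellF isCont_ellF)
  then have "(amp has_real_derivative inverse (1 / sqrt (speed2 (amp t)))) (at t)"
    using speed2_pos[of "amp t"]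
    by (intro DERIV_inverse_function[of ellF _ _ _ "t - 1" "t + 1"])
       (auto simp: ellF_amp ellF_deriv)
  then show ?thesis by (simp add: prof_def)
qed

text \<open>Landen's transformation: expressed through the angle \<open>amp t\<close>, this quotient
  is Jacobi's sn of modulus \<open>b\<close>. Unlike the sine of an amplitude of modulus
  \<open>b\<close>, the formula keeps its form whether |b| is below or above 1.\<close>

definition sn :: "real \<Rightarrow> real" where "sn t = sin (amp t) * cos (amp t) / prof t"

definition dsn :: "real \<Rightarrow> real" where
  "dsn t = (cos (amp t))\<^sup>2 - (sin (amp t))\<^sup>2 + b * (sn t)\<^sup>2"

lemma sin_cos_amp: "sin (amp t) * cos (amp t) = sn t * prof t"
  using prof_nz by (simp add: sn_def)

lemma prof_deriv: "(prof has_real_derivative - b * (sn t * prof t)) (at t)"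
proof -
  have s: "((\<lambda>t. a\<^sup>2 + b * (cos (amp t))\<^sup>2) has_real_derivative
      b * (2 * cos (amp t) * (- sin (amp t) * prof t))) (at t)"
    by (rule derivative_eq_intros amp_deriv refl | simp)+
  have "((\<lambda>t. sqrt (a\<^sup>2 + b * (cos (amp t))\<^sup>2)) has_real_derivative
      - b * (sn t * prof t)) (at t)"
    by (rule DERIV_cong[OF DERIV_chain2[OF DERIV_real_sqrt s]])
       (use speed2_pos[of "amp t"] prof_pos[of t] sin_cos_amp[of t] in
         \<open>simp_all add: speed2_eq prof_def[symmetric] field_simps flip: prof_sq\<close>)
  then show ?thesis
    by (simp add: prof_def[abs_def] speed2_eq)
qed

lemma sn_deriv: "(sn has_real_derivative dsn t) (at t)"
  unfolding sn_def[abs_def]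
  by (rule derivative_eq_intros amp_deriv prof_deriv prof_nz refl)+
     (use prof_nz[of t] sin_cos_amp[of t] in
        \<open>simp add: dsn_def field_simps power2_eq_square\<close>)

text \<open>The first integral x^2 = x'^2 + z'^2 of the profile, with x' = -b sn x and z' = x^2 -
  gamma inserted. Divided by x^2 it turns the potential into a polynomial in
  \<open>sn\<close>.\<close>

lemma sn_sq: "b\<^sup>2 * (sn t)\<^sup>2 * (prof t)\<^sup>2 = (prof t)\<^sup>2 - ((prof t)\<^sup>2 - gam a)\<^sup>2"
proof -
  have "(sn t)\<^sup>2 * (prof t)\<^sup>2 = (1 - (cos (amp t))\<^sup>2) * (cos (amp t))\<^sup>2"
    using sin_cos_amp[of t] by (metis power_mult_distrib sin_squared_eq)
  then have "b\<^sup>2 * (sn t)\<^sup>2 * (prof t)\<^sup>2 = b\<^sup>2 * ((1 - (cos (amp t))\<^sup>2) * (cos (amp t))\<^sup>2)"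
    by simp
  also have "\<dots> = (prof t)\<^sup>2 - ((prof t)\<^sup>2 - gam a)\<^sup>2"
    unfolding prof_sq b_def gam_def by algebra
  finally show ?thesis .
qed

definition pot :: "real \<Rightarrow> real" where
  "pot t = (prof t)\<^sup>2 + (gam a)\<^sup>2 / (prof t)\<^sup>2"

lemma pot_eq: "pot t = c - b\<^sup>2 * (sn t)\<^sup>2"
proof -
  have "(pot t - (c - b\<^sup>2 * (sn t)\<^sup>2)) * (prof t)\<^sup>2 = 0"
    using sn_sq[of t] prof_nz[of t]
    by (simp add: pot_def c_def algebra_simps power2_eq_square)
  then show ?thesis using prof_nz[of t] by simp
qed

text \<open>Thus \<open>sn\<close> solves the mode equation for j = 0. Up to the factor -b it is the
  component of the Gauss map along the axis, that is, the Jacobi field of a vertical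
  translation.\<close>

lemma dsn_deriv: "(dsn has_real_derivative - 2 * pot t * sn t) (at t)"
proof -
  have "(dsn has_real_derivative
      2 * cos (amp t) * (- sin (amp t) * prof t) - 2 * sin (amp t) * (cos (amp t) * prof t)
        + b * (2 * sn t * dsn t)) (at t)"
    unfolding dsn_def[abs_def]
    by (rule derivative_eq_intros amp_deriv sn_deriv refl | simp add: dsn_def)+
  also have "2 * cos (amp t) * (- sin (amp t) * prof t) - 2 * sin (amp t) * (cos (amp t) * prof t)
        + b * (2 * sn t * dsn t) = - 4 * (sin (amp t) * cos (amp t)) * prof t + b * (2 * sn t * dsn t)"
    by (simp add: algebra_simps)
  also have "\<dots> = sn t * (- 4 * (prof t)\<^sup>2 + 2 * b * dsn t)"
    unfolding sin_cos_amp by (simp add: algebra_simps power2_eq_square)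
  also have "\<dots> = - 2 * pot t * sn t"
    unfolding dsn_def prof_sq pot_eq sin_squared_eq
    by (simp add: b_def c_def gam_def algebra_simps power2_eq_square)
  finally show ?thesis .
qed

text \<open>In this autonomous form the equation is accessible to \<open>cubic_ode_unique\<close>,
  and all symmetries of \<open>sn\<close> follow from it.\<close>

lemma dsn_deriv_cubic: "(dsn has_real_derivative (- 2 * c) * sn t + (2 * b\<^sup>2) * sn t ^ 3) (at t)"
  using dsn_deriv[of t] by (simp add: pot_eq algebra_simps power2_eq_square power3_eq_cube)

lemma isCont_prof: "isCont prof t" and isCont_sn: "isCont sn t"
  using prof_deriv sn_deriv by (auto intro: DERIV_isCont)

lemma continuous_on_prof [continuous_intros]: "continuous_on S prof"
  by (simp add: continuous_at_imp_continuous_on isCont_prof)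

lemma continuous_on_sn [continuous_intros]: "continuous_on S sn"
  by (simp add: continuous_at_imp_continuous_on isCont_sn)

lemma continuous_on_pot [continuous_intros]: "continuous_on S pot"
  unfolding pot_eq[abs_def] by (intro continuous_intros)

definition height :: "real \<Rightarrow> real" where
  "height = primitive (\<lambda>t. (prof t)\<^sup>2 - gam a)"

lemma height_0: "height 0 = 0"
  and height_deriv: "(height has_real_derivative (prof t)\<^sup>2 - gam a) (at t)"
  unfolding height_def
  by (rule primitive, intro continuous_intros)+

lemma prof_0: "prof 0 = 1 + a"
  using a_gt by (simp add: prof_def speed2_def amp_0)

lemma sn_0: "sn 0 = 0" and dsn_0: "dsn 0 = 1"
  by (simp_all add: sn_def dsn_def amp_0)

lemma prof_deriv2:
  "((\<lambda>t. - b * (sn t * prof t)) has_real_derivative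
     (1 + 2 * gam a) * prof t - 2 * prof t ^ 3) (at t)"
proof -
  have "((\<lambda>t. - b * (sn t * prof t)) has_real_derivative
      - b * (dsn t * prof t + sn t * (- b * (sn t * prof t)))) (at t)"
    by (rule derivative_eq_intros sn_deriv prof_deriv refl | simp)+
  also have "- b * (dsn t * prof t + sn t * (- b * (sn t * prof t))) =
      - b * ((cos (amp t))\<^sup>2 - (sin (amp t))\<^sup>2) * prof t"
    by (simp add: dsn_def algebra_simps power2_eq_square)
  also have "\<dots> = ((1 + 2 * gam a) - 2 * (prof t)\<^sup>2) * prof t"
    unfolding prof_sq sin_squared_eq by (simp add: b_def gam_def algebra_simps power2_eq_square)
  finally show ?thesis
    by (simp add: algebra_simps power2_eq_square power3_eq_cube)
qed

lemma delaunay_ivp_prof: "delaunay_ivp a prof height"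
  unfolding delaunay_ivp_def
  by (intro exI[of _ "\<lambda>t. - b * (sn t * prof t)"])
     (use prof_deriv prof_deriv2 height_deriv height_0 prof_0 sn_0 in auto)

text \<open>The definite description in \<open>delaunay\<close> has a known value only once
  existence and uniqueness are both available. From then on every statement about the surface is one
  about \<open>prof\<close> and \<open>height\<close>.\<close>

lemma delaunay_ivp_unique:
  assumes "delaunay_ivp a x z"
  shows "x = prof" and "z = height"
proof -
  from assms obtain x' where x: "\<And>t. (x has_real_derivative x' t) (at t)"
    "\<And>t. (x' has_real_derivative ((1 + 2 * gam a) * x t - 2 * x t ^ 3)) (at t)"
    and z: "\<And>t. (z has_real_derivative ((x t)\<^sup>2 - gam a)) (at t)"
    and 0: "x 0 = 1 + a" "x' 0 = 0" "z 0 = 0"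
    unfolding delaunay_ivp_def by blast
  show xp: "x = prof"
    by (rule cubic_ode_unique[where A="1 + 2 * gam a" and B="-2" and u=x'
          and v="\<lambda>t. - b * (sn t * prof t)"])
       (use x 0 prof_deriv prof_deriv2 prof_0 sn_0 in auto)
  have "\<And>t. ((\<lambda>t. z t - height t) has_real_derivative 0) (at t)"
    using DERIV_diff[OF z height_deriv] by (simp add: xp)
  then have "z t - height t = z 0 - height 0" for t
    using DERIV_isconst_all by blast
  then show "z = height" using 0 height_0 by auto
qed

lemma delaunay_eq: "delaunay a = (prof, height)"
  unfolding delaunay_def
proof (rule the_equality)
  show "xz = (prof, height)" if "delaunay_ivp a (fst xz) (snd xz)" for xz
    using delaunay_ivp_unique[OF that] by (simp add: prod_eq_iff)
qed (simp add: delaunay_ivp_prof)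

lemma delaunay_x_eq: "delaunay_x a = prof" and delaunay_z_eq: "delaunay_z a = height"
  by (simp_all add: delaunay_x_def delaunay_z_def delaunay_eq)

section \<open>The half period and the symmetries of \<open>sn\<close>\<close>

definition tau :: real where "tau = ellF (pi/2)"

lemma tau_pos: "tau > 0"
  using strict_monoD[OF ellF_strict_mono, of 0 "pi/2"] ellF_0 by (simp add: tau_def)

text \<open>Factor the larger squared radius out of \<open>speed2\<close>: it is (1 + a)^2 for a >
  -1/2 and a^2 otherwise, which keeps the elliptic parameter in [0,1). In the second case the
  substitution pi/2 - \<theta> first exchanges sine and cosine.\<close>

lemma delaunay_tau_eq: "delaunay_tau a = tau"
proof (cases "a > -1/2")
  case True
  have "((\<lambda>\<theta>. 1 / sqrt (speed2 \<theta>)) has_integral ellF (pi/2) - ellF 0) {0..pi/2}"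
    by (rule fundamental_theorem_of_calculus)
       (auto simp: has_real_derivative_iff_has_vector_derivative[symmetric]
          intro!: has_field_derivative_at_within ellF_deriv)
  then have i: "((\<lambda>\<theta>. (1 + a) * (1 / sqrt (speed2 \<theta>))) has_integral (1 + a) * tau) {0..pi/2}"
    unfolding tau_def by (intro has_integral_mult_right) (simp add: ellF_0)
  have "(1 + a) * (1 / sqrt (speed2 \<theta>)) = 1 / sqrt (1 - (1 - a\<^sup>2 / (1 + a)\<^sup>2) * (sin \<theta>)\<^sup>2)" for \<theta>
  proof -
    have "1 - (1 - a\<^sup>2 / (1 + a)\<^sup>2) * (sin \<theta>)\<^sup>2 = speed2 \<theta> / (1 + a)\<^sup>2"
      using a_gt by (simp add: speed2_def cos_squared_eq field_simps)
    then show ?thesis using a_gt by (simp add: real_sqrt_divide)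
  qed
  then have "ellK (1 - a\<^sup>2 / (1 + a)\<^sup>2) = (1 + a) * tau"
    using i by (simp add: ellK_def integral_unique)
  then show ?thesis using True a_gt by (simp add: delaunay_tau_def)
next
  case False
  have "((\<lambda>\<theta>. 1 / sqrt (speed2 (pi/2 - \<theta>))) has_integral
      (- ellF (pi/2 - pi/2)) - (- ellF (pi/2 - 0))) {0..pi/2}"
  proof (rule fundamental_theorem_of_calculus)
    fix r :: real
    have "((\<lambda>\<theta>. - ellF (pi/2 - \<theta>)) has_real_derivative - (1 / sqrt (speed2 (pi/2 - r)) * (- 1))) (at r)"
      by (rule DERIV_minus DERIV_chain2[OF ellF_deriv] derivative_eq_intros refl | simp)+
    then show "((\<lambda>\<theta>. - ellF (pi/2 - \<theta>)) has_vector_derivative 1 / sqrt (speed2 (pi/2 - r)))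
        (at r within {0..pi/2})"
      by (simp add: has_real_derivative_iff_has_vector_derivative[symmetric] has_field_derivative_at_within)
  qed auto
  then have i: "((\<lambda>\<theta>. \<bar>a\<bar> * (1 / sqrt (speed2 (pi/2 - \<theta>)))) has_integral \<bar>a\<bar> * tau) {0..pi/2}"
    unfolding tau_def by (intro has_integral_mult_right) (simp add: ellF_0)
  have "\<bar>a\<bar> * (1 / sqrt (speed2 (pi/2 - \<theta>))) =
      1 / sqrt (1 - (1 - (1 + a)\<^sup>2 / a\<^sup>2) * (sin \<theta>)\<^sup>2)" for \<theta>
  proof -
    have co: "cos (pi/2 - \<theta>) = sin \<theta>" "sin (pi/2 - \<theta>) = cos \<theta>"
      by (simp_all add: cos_diff sin_diff)
    have "1 - (1 - (1 + a)\<^sup>2 / a\<^sup>2) * (sin \<theta>)\<^sup>2 = speed2 (pi/2 - \<theta>) / a\<^sup>2"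
      unfolding speed2_def co using a_nz by (simp add: cos_squared_eq field_simps)
    then show ?thesis using a_nz by (simp add: real_sqrt_divide)
  qed
  then have "ellK (1 - (1 + a)\<^sup>2 / a\<^sup>2) = \<bar>a\<bar> * tau"
    using i by (simp add: ellK_def integral_unique)
  then show ?thesis using False a_nz by (simp add: delaunay_tau_def)
qed

lemma amp_tau: "amp tau = pi/2"
  by (simp add: tau_def amp_ellF)

lemma sn_tau: "sn tau = 0" and dsn_tau: "dsn tau = -1"
  by (simp_all add: sn_def dsn_def amp_tau)

lemma sn_pos:
  assumes "t \<in> {0<..<tau}"
  shows "sn t > 0"
proof -
  have "ellF 0 < ellF (amp t)" "ellF (amp t) < ellF (pi/2)"
    using assms by (auto simp: ellF_0 ellF_amp tau_def)
  then have "0 < amp t" "amp t < pi/2"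
    by (simp_all add: strict_mono_less[OF ellF_strict_mono])
  then show ?thesis
    using prof_pos[of t] by (simp add: sn_def sin_gt_zero2 cos_gt_zero)
qed

text \<open>The tool for the symmetries: a reflected or translated copy of \<open>sn\<close> is
  recognized by its initial data.\<close>

lemma sn_unique:
  assumes "\<And>t. (y has_real_derivative v t) (at t)"
    and "\<And>t. (v has_real_derivative (- 2 * c) * y t + (2 * b\<^sup>2) * y t ^ 3) (at t)"
    and "y 0 = 0" "v 0 = 1"
  shows "y = sn"
  by (rule cubic_ode_unique[where A="- 2 * c" and B="2 * b\<^sup>2" and u=v and v=dsn])
     (use assms sn_deriv dsn_deriv_cubic sn_0 dsn_0 in auto)

lemma sn_odd: "sn (- t) = - sn t"
proof -
  have "(\<lambda>t. - sn (- t)) = sn"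
  proof (rule sn_unique[where v="\<lambda>t. dsn (- t)"])
    fix t
    show "((\<lambda>t. - sn (- t)) has_real_derivative dsn (- t)) (at t)"
      using DERIV_minus[OF sn_deriv[of "- t", unfolded DERIV_mirror]] by simp
    show "((\<lambda>t. dsn (- t)) has_real_derivative
        (- 2 * c) * - sn (- t) + (2 * b\<^sup>2) * (- sn (- t)) ^ 3) (at t)"
      using dsn_deriv_cubic[of "- t", unfolded DERIV_mirror] by simp
  qed (simp_all add: sn_0 dsn_0)
  then show ?thesis by (metis minus_minus)
qed

lemma pot_even: "pot (- t) = pot t"
  by (simp add: pot_eq sn_odd)

lemma sn_shift: "sn (t + tau) = - sn t"
proof -
  have "(\<lambda>t. - sn (t + tau)) = sn"
  proof (rule sn_unique[where v="\<lambda>t. - dsn (t + tau)"])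
    fix t
    show "((\<lambda>t. - sn (t + tau)) has_real_derivative - dsn (t + tau)) (at t)"
      using DERIV_minus[OF sn_deriv[of "t + tau", unfolded DERIV_shift]] by simp
    show "((\<lambda>t. - dsn (t + tau)) has_real_derivative
        (- 2 * c) * - sn (t + tau) + (2 * b\<^sup>2) * (- sn (t + tau)) ^ 3) (at t)"
      using DERIV_minus[OF dsn_deriv_cubic[of "t + tau", unfolded DERIV_shift]] by simp
  qed (simp_all add: sn_tau dsn_tau)
  then show ?thesis by (metis minus_minus)
qed

lemma dsn_shift: "dsn (t + tau) = - dsn t"
proof -
  have "((\<lambda>t. sn (t + tau)) has_real_derivative dsn (t + tau)) (at t)"
    using sn_deriv[of "t + tau"] by (simp add: DERIV_shift)
  moreover have "((\<lambda>t. sn (t + tau)) has_real_derivative - dsn t) (at t)"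
    unfolding sn_shift by (rule DERIV_minus[OF sn_deriv])
  ultimately show ?thesis by (rule DERIV_unique)
qed

lemma sn_shift_mult: "sn (t + real k * tau) = (-1) ^ k * sn t"
  and dsn_shift_mult: "dsn (t + real k * tau) = (-1) ^ k * dsn t"
  by (induction k) (use sn_shift[of "t + real _ * tau"] dsn_shift[of "t + real _ * tau"] in
    \<open>simp_all add: algebra_simps\<close>)

lemma dsn_half: "dsn (tau / 2) = 0"
proof -
  have eq: "(\<lambda>t. sn (tau + - t)) = sn"
    using sn_shift[of "- t" for t] by (simp add: sn_odd add.commute)
  have "((\<lambda>t. sn (tau + - t)) has_real_derivative - dsn (tau / 2)) (at (tau / 2))"
    by (rule DERIV_cong[OF DERIV_chain2[OF sn_deriv]])
       (rule derivative_eq_intros refl | simp add: field_simps)+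
  then have "(sn has_real_derivative - dsn (tau / 2)) (at (tau / 2))"
    by (simp only: eq)
  from DERIV_unique[OF this sn_deriv] show ?thesis by simp
qed

text \<open>Antiperiodicity reduces the question to [0,tau). At 0 the value is 1, and on (0,tau) the
  function \<open>dsn\<close> decreases strictly because \<open>sn\<close> and \<open>pot\<close>
  are positive there; so tau/2 is its only zero.\<close>

lemma dsn_zero_iff:
  assumes "0 \<le> t"
  shows "dsn t = 0 \<longleftrightarrow> (\<exists>k::nat. t = (real k + 1/2) * tau)"
proof
  assume "\<exists>k::nat. t = (real k + 1/2) * tau"
  then obtain k :: nat where "t = tau / 2 + real k * tau" by (auto simp: algebra_simps)
  then show "dsn t = 0" by (simp add: dsn_shift_mult dsn_half)
next
  assume z: "dsn t = 0"
  define k where "k = nat \<lfloor>t / tau\<rfloor>"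
  define r where "r = t - real k * tau"
  have "real k = of_int \<lfloor>t / tau\<rfloor>" using assms tau_pos by (simp add: k_def)
  then have "real k \<le> t / tau" "t / tau < real k + 1" by linarith+
  then have r: "0 \<le> r" "r < tau" using tau_pos by (auto simp: r_def field_simps)
  have t: "t = r + real k * tau" by (simp add: r_def)
  then have rz: "dsn r = 0" using z by (simp add: dsn_shift_mult)
  then have r0: "r > 0" using r dsn_0 by (cases "r = 0") auto
  have "r = tau / 2"
  proof (rule ccontr)
    assume ne: "r \<noteq> tau / 2"
    have dec: "dsn v < dsn u" if uv: "0 < u" "u < v" "v < tau" for u v
    proof (rule DERIV_neg_imp_decreasing[OF uv(2)])
      fix y assume "u \<le> y" "y \<le> v"
      then have "sn y > 0" using uv by (intro sn_pos) auto
      moreover have "pot y > 0" using prof_pos[of y] by (auto simp: pot_def intro!: add_pos_nonneg)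
      ultimately show "\<exists>z. (dsn has_real_derivative z) (at y) \<and> z < 0"
        using dsn_deriv[of y] by (intro exI[of _ "- 2 * pot y * sn y"]) auto
    qed
    show False
      using dec[of r "tau / 2"] dec[of "tau / 2" r] r r0 rz dsn_half tau_pos ne
      by (cases "r < tau / 2") auto
  qed
  then show "\<exists>k::nat. t = (real k + 1/2) * tau"
    using t by (intro exI[of _ k]) (simp add: algebra_simps)
qed

section \<open>The comparison functions\<close>

definition dn :: "real \<Rightarrow> real" where "dn t = prof t - gam a / prof t"
text \<open>Geometrically, \<open>kap / prof\<close> and \<open>dn / prof\<close> are the principal
  curvatures along meridians and parallels. Their sum is 2, and the sum of their squares is 2 pot /
  prof^2.\<close>

definition kap :: "real \<Rightarrow> real" where "kap t = prof t + gam a / prof t"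

lemma dn_deriv: "(dn has_real_derivative - b * sn t * kap t) (at t)"
  unfolding dn_def[abs_def] kap_def
  by (rule derivative_eq_intros prof_deriv prof_nz refl)+
     (use prof_nz[of t] in \<open>simp add: field_simps power2_eq_square\<close>)

lemma kap_deriv: "(kap has_real_derivative - b * sn t * dn t) (at t)"
  unfolding kap_def[abs_def] dn_def
  by (rule derivative_eq_intros prof_deriv prof_nz refl)+
     (use prof_nz[of t] in \<open>simp add: field_simps power2_eq_square\<close>)

lemma kap_sq: "(kap t)\<^sup>2 = pot t + 2 * gam a"
  and dn_sq: "(dn t)\<^sup>2 = pot t - 2 * gam a"
  using prof_nz[of t] by (simp_all add: kap_def dn_def pot_def field_simps power2_eq_square)

text \<open>The classical sn' = cn dn, multiplied by \<open>b\<close> because \<open>kap\<close>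
  stands for b cn; both sides vanish for b = 0.\<close>

lemma b_dsn: "b * dsn t = dn t * kap t"
proof -
  have "b * ((cos (amp t))\<^sup>2 - (sin (amp t))\<^sup>2) = 2 * (prof t)\<^sup>2 - c"
    unfolding prof_sq sin_squared_eq
    by (simp add: b_def c_def gam_def algebra_simps power2_eq_square)
  then have "b * dsn t = 2 * (prof t)\<^sup>2 - c + b\<^sup>2 * (sn t)\<^sup>2"
    by (simp add: dsn_def algebra_simps power2_eq_square)
  also have "\<dots> = 2 * (prof t)\<^sup>2 - pot t" by (simp add: pot_eq)
  also have "\<dots> = dn t * kap t"
    using prof_nz[of t] by (simp add: pot_def dn_def kap_def field_simps power2_eq_square)
  finally show ?thesis .
qed

lemma q_deriv: "((\<lambda>t. - b * sn t) has_real_derivative - dn t * kap t) (at t)"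
  using DERIV_cmult[OF sn_deriv, of "-b" t] b_dsn[of t] by simp

lemma dn_deriv2:
  "((\<lambda>t. - b * sn t * kap t) has_real_derivative (1 - 2 * pot t) * dn t) (at t)"
proof -
  have "((\<lambda>t. - b * sn t * kap t) has_real_derivative
     - dn t * kap t * kap t + (- b * sn t * dn t) * (- b * sn t)) (at t)"
    by (rule DERIV_mult[OF q_deriv kap_deriv])
  also have "- dn t * kap t * kap t + (- b * sn t * dn t) * (- b * sn t) =
      dn t * (b\<^sup>2 * (sn t)\<^sup>2 - (kap t)\<^sup>2)"
    by (simp add: algebra_simps power2_eq_square)
  also have "\<dots> = (1 - 2 * pot t) * dn t"
    by (simp add: kap_sq pot_eq c_def)
  finally show ?thesis .
qed

lemma kap_deriv2:
  "((\<lambda>t. - b * sn t * dn t) has_real_derivative (b\<^sup>2 - 2 * pot t) * kap t) (at t)"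
proof -
  have "((\<lambda>t. - b * sn t * dn t) has_real_derivative
     - dn t * kap t * dn t + (- b * sn t * kap t) * (- b * sn t)) (at t)"
    by (rule DERIV_mult[OF q_deriv dn_deriv])
  also have "- dn t * kap t * dn t + (- b * sn t * kap t) * (- b * sn t) =
      kap t * (b\<^sup>2 * (sn t)\<^sup>2 - (dn t)\<^sup>2)"
    by (simp add: algebra_simps power2_eq_square)
  also have "b\<^sup>2 * (sn t)\<^sup>2 - (dn t)\<^sup>2 = b\<^sup>2 - 2 * pot t"
    using c_eq by (simp add: dn_sq pot_eq c_def)
  finally show ?thesis by (simp add: mult.commute)
qed

end

section \<open>The Jacobi operator\<close>

lemma has_vector_derivative_vector_3:
  fixes x y z :: "real \<Rightarrow> real"
  assumes "(x has_real_derivative x') (at t within S)"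
    and "(y has_real_derivative y') (at t within S)"
    and "(z has_real_derivative z') (at t within S)"
  shows "((\<lambda>t. vector [x t, y t, z t] :: real^3) has_vector_derivative vector [x', y', z']) (at t within S)"
proof -
  have eq: "vector [u, v, w] = u *\<^sub>R axis 1 1 + v *\<^sub>R axis 2 1 + w *\<^sub>R (axis 3 1 :: real^3)"
    for u v w :: real
    by (simp add: vec_eq_iff forall_3 axis_def)
  show ?thesis unfolding eq
    by (rule derivative_eq_intros assms refl | simp)+
qed

text \<open>The tangent vectors have no cross terms: \<open>Xt\<close> has no part along H and
  \<open>Xh\<close> none along T. Their cross product is therefore AB N - AQ H - PB T, of squared
  length E G - F^2 = D, and the mean curvature becomes a polynomial divided by 2 D^(3/2).\<close>

lemma mean_curvature_in_frame:
  fixes T H N :: "real^3" and A B P Q n1 n2 n3 m1 m2 m3 l1 l2 l3 :: real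
  assumes on: "T \<bullet> T = 1" "H \<bullet> H = 1" "N \<bullet> N = 1" "T \<bullet> H = 0" "T \<bullet> N = 0" "H \<bullet> N = 0"
    and cr: "cross3 T H = N" "cross3 T N = - H" "cross3 N H = - T"
  defines "Xt \<equiv> A *\<^sub>R T + P *\<^sub>R N" and "Xh \<equiv> B *\<^sub>R H + Q *\<^sub>R N"
  defines "\<nu> \<equiv> (1 / norm (cross3 Xt Xh)) *\<^sub>R cross3 Xt Xh"
  defines "D \<equiv> A\<^sup>2 * B\<^sup>2 + A\<^sup>2 * Q\<^sup>2 + B\<^sup>2 * P\<^sup>2"
  shows "((norm Xt)\<^sup>2 * ((n1 *\<^sub>R T + n2 *\<^sub>R H + n3 *\<^sub>R N) \<bullet> \<nu>)
      - 2 * (Xt \<bullet> Xh) * ((m1 *\<^sub>R T + m2 *\<^sub>R H + m3 *\<^sub>R N) \<bullet> \<nu>)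
      + (norm Xh)\<^sup>2 * ((l1 *\<^sub>R T + l2 *\<^sub>R H + l3 *\<^sub>R N) \<bullet> \<nu>))
      / (2 * ((norm Xt)\<^sup>2 * (norm Xh)\<^sup>2 - (Xt \<bullet> Xh)\<^sup>2)) =
    ((A\<^sup>2 + P\<^sup>2) * (A * B * n3 - A * Q * n2 - P * B * n1)
      - 2 * (P * Q) * (A * B * m3 - A * Q * m2 - P * B * m1)
      + (B\<^sup>2 + Q\<^sup>2) * (A * B * l3 - A * Q * l2 - P * B * l1)) / (2 * (D * sqrt D))"
proof -
  have on': "H \<bullet> T = 0" "N \<bullet> T = 0" "N \<bullet> H = 0"
    using on by (simp_all add: inner_commute)
  define V where "V = (A * B) *\<^sub>R N - (A * Q) *\<^sub>R H - (P * B) *\<^sub>R T"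
  have V: "cross3 Xt Xh = V"
    unfolding Xt_def Xh_def V_def
    by (simp add: cross_add_left cross_add_right cross_mult_left cross_mult_right cr algebra_simps)
  have E: "(norm Xt)\<^sup>2 = A\<^sup>2 + P\<^sup>2"
    unfolding power2_norm_eq_inner Xt_def
    by (simp add: inner_simps on on' power2_eq_square)
  have G: "(norm Xh)\<^sup>2 = B\<^sup>2 + Q\<^sup>2"
    unfolding power2_norm_eq_inner Xh_def
    by (simp add: inner_simps on on' power2_eq_square)
  have F: "Xt \<bullet> Xh = P * Q"
    unfolding Xt_def Xh_def by (simp add: inner_simps on on')
  have "(norm V)\<^sup>2 = D"
    unfolding power2_norm_eq_inner V_def D_def
    by (simp add: inner_simps on on' power2_eq_square algebra_simps)
  then have nV: "norm V = sqrt D" by (metis norm_ge_zero real_sqrt_unique)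
  have EG: "(A\<^sup>2 + P\<^sup>2) * (B\<^sup>2 + Q\<^sup>2) - (P * Q)\<^sup>2 = D"
    by (simp add: D_def power2_eq_square algebra_simps)
  have c: "(k1 *\<^sub>R T + k2 *\<^sub>R H + k3 *\<^sub>R N) \<bullet> \<nu> = (A * B * k3 - A * Q * k2 - P * B * k1) / sqrt D"
    for k1 k2 k3
    unfolding \<nu>_def V nV unfolding V_def
    by (simp add: inner_simps on on' algebra_simps diff_divide_distrib add_divide_distrib)
  have "(e * (x / r) - f * (y / r) + g * (z / r)) / (2 * D) =
      (e * x - f * y + g * z) / (2 * (D * r))" for e f g x y z r :: real
    by (simp add: add_divide_distrib diff_divide_distrib mult.commute mult.left_commute)
  then show ?thesis
    unfolding E F G c EG .
qed

text \<open>The linearization as scalar calculus in s, with the coefficients of the normal variation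
  in the moving frame. At s = 0 the denominator is 2 x^6 and the numerator x^5 (k + d). The two
  first-order terms in ut q, one from X_tt and one from X_theta_theta, cancel; \<open>uh\<close>,
  \<open>uth\<close> and \<open>l\<close> enter only at higher order.\<close>

lemma frame_mean_curvature_deriv:
  fixes x k d q u ut uh utt uth uhh l :: real
  assumes x: "x > 0" and kd: "k + d = 2 * x"
  defines "A \<equiv> \<lambda>s. x - s * u * k" and "B \<equiv> \<lambda>s. x - s * u * d"
  defines "P \<equiv> \<lambda>s. s * ut" and "Q \<equiv> \<lambda>s. s * uh"
  defines "D \<equiv> \<lambda>s. (A s)\<^sup>2 * (B s)\<^sup>2 + (A s)\<^sup>2 * (Q s)\<^sup>2 + (B s)\<^sup>2 * (P s)\<^sup>2"
  defines "num \<equiv> \<lambda>s.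
      ((A s)\<^sup>2 + (P s)\<^sup>2) * (A s * B s * (B s * d + s * uhh) - A s * Q s * (- 2 * s * uh * d)
          - P s * B s * (- B s * q))
      - 2 * (P s * Q s) * (A s * B s * (s * uth) - A s * Q s * (A s * q - s * ut * d)
          - P s * B s * (- s * uh * k))
      + ((B s)\<^sup>2 + (Q s)\<^sup>2) * (A s * B s * (A s * k + s * utt) - A s * Q s * 0
          - P s * B s * (x * q - 2 * s * ut * k - s * u * l))"
  shows "((\<lambda>s. num s / (2 * (D s * sqrt (D s)))) has_real_derivative
      (utt + uhh + (k\<^sup>2 + d\<^sup>2) * u) / (2 * x\<^sup>2)) (at 0)"
proof -
  have dA: "(A has_real_derivative - (u * k)) (at 0)"
    and dB: "(B has_real_derivative - (u * d)) (at 0)"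
    and dP: "(P has_real_derivative ut) (at 0)"
    and dQ: "(Q has_real_derivative uh) (at 0)"
    unfolding A_def B_def P_def Q_def
    by (rule derivative_eq_intros refl | simp)+
  have at0: "A 0 = x" "B 0 = x" "P 0 = 0" "Q 0 = 0"
    by (simp_all add: A_def B_def P_def Q_def)
  have dD: "(D has_real_derivative - 4 * x ^ 4 * u) (at 0)"
  proof -
    have "(D has_real_derivative - 2 * x ^ 3 * u * (k + d)) (at 0)"
      unfolding D_def
      by (rule derivative_eq_intros dA dB dP dQ refl)+
         (simp add: at0 algebra_simps power2_eq_square power3_eq_cube)
    then show ?thesis unfolding kd by (simp add: algebra_simps power_numeral_reduce)
  qed
  have dnum: "(num has_real_derivative x ^ 4 * (utt + uhh - 2 * u * (k\<^sup>2 + 3 * k * d + d\<^sup>2))) (at 0)"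
    unfolding num_def
    by (rule derivative_eq_intros dA dB dP dQ refl)+
       (simp add: at0 algebra_simps power2_eq_square power_numeral_reduce)
  have D0: "D 0 = x ^ 4" by (simp add: D_def at0 flip: power_add)
  then have sqrt_D0: "sqrt (D 0) = x\<^sup>2" by (intro real_sqrt_unique) (simp_all flip: power_mult)
  have num0: "num 0 = x ^ 5 * (k + d)"
    by (simp add: num_def at0 algebra_simps power_numeral_reduce)
  have dS: "((\<lambda>s. sqrt (D s)) has_real_derivative - 2 * x\<^sup>2 * u) (at 0)"
  proof (rule DERIV_cong[OF DERIV_chain2[OF DERIV_real_sqrt dD]])
    show "0 < D 0" using x by (simp add: D0)
    show "inverse (sqrt (D 0)) / 2 * (- 4 * x ^ 4 * u) = - 2 * x\<^sup>2 * u"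
      unfolding sqrt_D0 using x by (simp add: field_simps power_numeral_reduce)
  qed
  have dDS: "((\<lambda>s. 2 * (D s * sqrt (D s))) has_real_derivative - 12 * x ^ 6 * u) (at 0)"
    by (rule DERIV_cong[OF DERIV_cmult[OF DERIV_mult[OF dD dS]]])
       (unfold sqrt_D0, unfold D0, simp add: algebra_simps power_numeral_reduce)
  \<comment> \<open>Here mean curvature 1 is used: with k + d = 2x fixed, the quadratic form from
    the numerator reduces to k^2 + d^2, the zeroth-order term of the Jacobi operator.\<close>
  have sq: "k\<^sup>2 + 3 * k * d + d\<^sup>2 = 6 * x\<^sup>2 - (k\<^sup>2 + d\<^sup>2) / 2"
  proof -
    have d: "d = 2 * x - k" using kd by simp
    show ?thesis unfolding d by (simp add: field_simps power2_eq_square)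
  qed
  show ?thesis
    by (rule DERIV_cong[OF DERIV_divide[OF dnum dDS]])
       (use x in \<open>unfold sqrt_D0, unfold D0 num0 kd sq, simp_all add: field_simps power_numeral_reduce\<close>)
qed

context delaunay_param
begin

section \<open>The moving frame of the Delaunay surface\<close>

definition qn :: "real \<Rightarrow> real" where "qn t = - b * sn t"

lemma qn_dn_sq: "(qn t)\<^sup>2 + (dn t)\<^sup>2 = 1"
  by (simp add: qn_def dn_sq pot_eq c_def power_mult_distrib)

text \<open>The parametrization is conformal with factor \<open>prof\<close>: T and H are X_t and
  X_theta divided by it, and N is the Gauss map. Here qn = x'/x and dn = z'/x, so T is a unit vector
  by the first integral of the profile.\<close>

definition frT :: "real \<Rightarrow> real \<Rightarrow> real^3" where
  "frT t \<theta> = vector [qn t * cos \<theta>, qn t * sin \<theta>, dn t]"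
definition frH :: "real \<Rightarrow> real^3" where
  "frH \<theta> = vector [- sin \<theta>, cos \<theta>, 0]"
definition frN :: "real \<Rightarrow> real \<Rightarrow> real^3" where
  "frN t \<theta> = vector [- dn t * cos \<theta>, - dn t * sin \<theta>, qn t]"

lemma frame_orthonormal:
  "frT t \<theta> \<bullet> frT t \<theta> = 1" "frH \<theta> \<bullet> frH \<theta> = 1" "frN t \<theta> \<bullet> frN t \<theta> = 1"
  "frT t \<theta> \<bullet> frH \<theta> = 0" "frT t \<theta> \<bullet> frN t \<theta> = 0" "frH \<theta> \<bullet> frN t \<theta> = 0"
proof -
  have tr: "(cos \<theta>)\<^sup>2 = 1 - (sin \<theta>)\<^sup>2" by (rule cos_squared_eq)
  have qd: "(qn t)\<^sup>2 = 1 - (dn t)\<^sup>2" using qn_dn_sq[of t] by simp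
  show "frT t \<theta> \<bullet> frT t \<theta> = 1" "frH \<theta> \<bullet> frH \<theta> = 1" "frN t \<theta> \<bullet> frN t \<theta> = 1"
  "frT t \<theta> \<bullet> frH \<theta> = 0" "frT t \<theta> \<bullet> frN t \<theta> = 0" "frH \<theta> \<bullet> frN t \<theta> = 0"
    using tr qd
    unfolding frT_def frH_def frN_def inner_vec_def sum_3
    by (simp_all, algebra+)
qed

lemma frame_cross:
  "cross3 (frT t \<theta>) (frH \<theta>) = frN t \<theta>" "cross3 (frT t \<theta>) (frN t \<theta>) = - frH \<theta>"
  "cross3 (frN t \<theta>) (frH \<theta>) = - frT t \<theta>"
proof -
  have tr: "(cos \<theta>)\<^sup>2 = 1 - (sin \<theta>)\<^sup>2" by (rule cos_squared_eq)
  have qd: "(qn t)\<^sup>2 = 1 - (dn t)\<^sup>2" using qn_dn_sq[of t] by simp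
  show "cross3 (frT t \<theta>) (frH \<theta>) = frN t \<theta>" "cross3 (frT t \<theta>) (frN t \<theta>) = - frH \<theta>"
  "cross3 (frN t \<theta>) (frH \<theta>) = - frT t \<theta>"
    using tr qd
    unfolding frT_def frH_def frN_def cross3_def vec_eq_iff forall_3
    by (simp_all, algebra+)
qed

lemmas within_derivs =
  has_field_derivative_at_within[OF q_deriv] has_field_derivative_at_within[OF dn_deriv]
  has_field_derivative_at_within[OF DERIV_minus[OF dn_deriv]]
  has_field_derivative_at_within[OF prof_deriv] has_field_derivative_at_within[OF height_deriv]

lemma frT_deriv: "((\<lambda>t. frT t \<theta>) has_vector_derivative kap t *\<^sub>R frN t \<theta>) (at t within I)"
proof -
  have "kap t *\<^sub>R frN t \<theta> =
      vector [(- dn t * kap t) * cos \<theta>, (- dn t * kap t) * sin \<theta>, qn t * kap t]"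
    by (simp add: frN_def vec_eq_iff forall_3)
  then show ?thesis unfolding frT_def qn_def
    by (simp only:) (rule has_vector_derivative_vector_3[OF DERIV_cmult_right DERIV_cmult_right];
      rule within_derivs)+
qed

lemma frN_deriv: "((\<lambda>t. frN t \<theta>) has_vector_derivative - kap t *\<^sub>R frT t \<theta>) (at t within I)"
proof -
  have "- kap t *\<^sub>R frT t \<theta> =
      vector [(- (qn t * kap t)) * cos \<theta>, (- (qn t * kap t)) * sin \<theta>, - dn t * kap t]"
    by (simp add: frT_def vec_eq_iff forall_3)
  then show ?thesis unfolding frN_def qn_def
    by (simp only:) (rule has_vector_derivative_vector_3[OF DERIV_cmult_right DERIV_cmult_right];
      rule within_derivs)+
qed

lemma frT_deriv_th: "((\<lambda>\<theta>. frT t \<theta>) has_vector_derivative qn t *\<^sub>R frH \<theta>) (at \<theta>)"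
proof -
  have "qn t *\<^sub>R frH \<theta> = vector [qn t * - sin \<theta>, qn t * cos \<theta>, 0]"
    by (simp add: frH_def vec_eq_iff forall_3)
  then show ?thesis unfolding frT_def
    by (simp only:) (intro has_vector_derivative_vector_3 DERIV_cmult DERIV_sin DERIV_cos DERIV_const)
qed

lemma frN_deriv_th: "((\<lambda>\<theta>. frN t \<theta>) has_vector_derivative - dn t *\<^sub>R frH \<theta>) (at \<theta>)"
proof -
  have "- dn t *\<^sub>R frH \<theta> = vector [- dn t * - sin \<theta>, - dn t * cos \<theta>, 0]"
    by (simp add: frH_def vec_eq_iff forall_3)
  then show ?thesis unfolding frN_def
    by (simp only:) (intro has_vector_derivative_vector_3 DERIV_cmult DERIV_sin DERIV_cos DERIV_const)
qed

lemma frH_deriv_th: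
  "(frH has_vector_derivative - (qn t *\<^sub>R frT t \<theta>) + dn t *\<^sub>R frN t \<theta>) (at \<theta>)"
proof -
  have qd: "(qn t)\<^sup>2 = 1 - (dn t)\<^sup>2" using qn_dn_sq[of t] by simp
  have "- (qn t *\<^sub>R frT t \<theta>) + dn t *\<^sub>R frN t \<theta> = vector [- cos \<theta>, - sin \<theta>, 0]"
    using qd unfolding frT_def frN_def vec_eq_iff forall_3
    by (simp, algebra)
  then show ?thesis unfolding frH_def[abs_def]
    by (simp only:) (intro has_vector_derivative_vector_3 DERIV_minus DERIV_sin DERIV_cos DERIV_const)
qed

lemma surf_deriv:
  "((\<lambda>t. delaunay_surf a t \<theta>) has_vector_derivative prof t *\<^sub>R frT t \<theta>) (at t within I)"
proof -
  have "prof t *\<^sub>R frT t \<theta> = vector [(- b * (sn t * prof t)) * cos \<theta>,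
      (- b * (sn t * prof t)) * sin \<theta>, (prof t)\<^sup>2 - gam a]"
    using prof_nz[of t]
    by (simp add: frT_def qn_def dn_def vec_eq_iff forall_3 power2_eq_square algebra_simps)
  then show ?thesis unfolding delaunay_surf_def delaunay_x_eq delaunay_z_eq
    by (simp only:) (rule has_vector_derivative_vector_3[OF DERIV_cmult_right DERIV_cmult_right];
      rule within_derivs)+
qed

lemma surf_deriv_th:
  "((\<lambda>\<theta>. delaunay_surf a t \<theta>) has_vector_derivative prof t *\<^sub>R frH \<theta>) (at \<theta>)"
proof -
  have "prof t *\<^sub>R frH \<theta> = vector [prof t * - sin \<theta>, prof t * cos \<theta>, 0]"
    by (simp add: frH_def vec_eq_iff forall_3)
  then show ?thesis unfolding delaunay_surf_def delaunay_x_eq delaunay_z_eq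
    by (simp only:) (intro has_vector_derivative_vector_3 DERIV_cmult DERIV_sin DERIV_cos DERIV_const)
qed

lemma unit_normal_surf: "unit_normal UNIV (delaunay_surf a) t \<theta> = frN t \<theta>"
proof -
  have "partial_t UNIV (delaunay_surf a) t \<theta> = prof t *\<^sub>R frT t \<theta>"
    unfolding partial_t_def using surf_deriv[of \<theta> t UNIV] by (rule vector_derivative_at)
  moreover have "partial_th (delaunay_surf a) t \<theta> = prof t *\<^sub>R frH \<theta>"
    unfolding partial_th_def using surf_deriv_th by (rule vector_derivative_at)
  moreover have "norm (frN t \<theta>) = 1"
    by (simp add: norm_eq_1 frame_orthonormal)
  ultimately show ?thesis
    using prof_nz[of t] by (simp add: unit_normal_def cross_mult_left cross_mult_right frame_cross)
qed

text \<open>Expanded in the frame, the derivatives of the varied surface have exactly the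
  coefficients of \<open>frame_mean_curvature_deriv\<close>, with \<open>l\<close> the derivative of
  \<open>kap\<close>. The condition on \<open>at t within I\<close> makes the one-sided derivatives
  unique, so that the formula also holds at the endpoints of a compact interval.\<close>

lemma jacobi_op_eq:
  fixes \<phi> f1 f2 f11 f12 f22 :: "real \<Rightarrow> real \<Rightarrow> real"
  assumes I: "\<And>t. t \<in> I \<Longrightarrow> at t within I \<noteq> bot"
    and d1: "\<And>t \<theta>. t \<in> I \<Longrightarrow> ((\<lambda>t. \<phi> t \<theta>) has_real_derivative f1 t \<theta>) (at t within I)"
    and d2: "\<And>t \<theta>. t \<in> I \<Longrightarrow> ((\<lambda>\<theta>. \<phi> t \<theta>) has_real_derivative f2 t \<theta>) (at \<theta>)"
    and d11: "\<And>t \<theta>. t \<in> I \<Longrightarrow> ((\<lambda>t. f1 t \<theta>) has_real_derivative f11 t \<theta>) (at t within I)"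
    and d12: "\<And>t \<theta>. t \<in> I \<Longrightarrow> ((\<lambda>\<theta>. f1 t \<theta>) has_real_derivative f12 t \<theta>) (at \<theta>)"
    and d22: "\<And>t \<theta>. t \<in> I \<Longrightarrow> ((\<lambda>\<theta>. f2 t \<theta>) has_real_derivative f22 t \<theta>) (at \<theta>)"
    and t: "t \<in> I"
  shows "jacobi_op a I \<phi> t \<theta> = (f11 t \<theta> + f22 t \<theta> + 2 * pot t * \<phi> t \<theta>) / (2 * (prof t)\<^sup>2)"
proof -
  define Y where "Y s = (\<lambda>t \<theta>. delaunay_surf a t \<theta> + (s * \<phi> t \<theta>) *\<^sub>R frN t \<theta>)" for s
  define A where "A s t \<theta> = prof t - s * \<phi> t \<theta> * kap t" for s t \<theta>
  define B where "B s t \<theta> = prof t - s * \<phi> t \<theta> * dn t" for s t \<theta>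
  have Yt: "partial_t I (Y s) r \<theta> = A s r \<theta> *\<^sub>R frT r \<theta> + (s * f1 r \<theta>) *\<^sub>R frN r \<theta>"
    if r: "r \<in> I" for s r \<theta>
    unfolding partial_t_def Y_def
    by (rule vector_derivative_within[OF I[OF r]])
       (rule derivative_eq_intros surf_deriv frN_deriv d1[OF r] refl
          | simp add: A_def algebra_simps)+
  have Yh: "partial_th (Y s) r \<theta> = B s r \<theta> *\<^sub>R frH \<theta> + (s * f2 r \<theta>) *\<^sub>R frN r \<theta>"
    if r: "r \<in> I" for s r \<theta>
    unfolding partial_th_def Y_def
    by (rule vector_derivative_at)
       (rule derivative_eq_intros surf_deriv_th frN_deriv_th d2[OF r] refl
          | simp add: B_def algebra_simps)+
  have Ytt: "partial_t I (partial_t I (Y s)) t \<theta> =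
      (prof t * qn t - 2 * s * f1 t \<theta> * kap t - s * \<phi> t \<theta> * (- b * sn t * dn t)) *\<^sub>R frT t \<theta> + 0 *\<^sub>R frH \<theta>
      + (A s t \<theta> * kap t + s * f11 t \<theta>) *\<^sub>R frN t \<theta>" for s
  proof -
    have "((\<lambda>r. A s r \<theta> *\<^sub>R frT r \<theta> + (s * f1 r \<theta>) *\<^sub>R frN r \<theta>) has_vector_derivative
      (A s t \<theta> *\<^sub>R (kap t *\<^sub>R frN t \<theta>) + (- b * (sn t * prof t) -
         ((s * f1 t \<theta>) * kap t + (- b * sn t * dn t) * (s * \<phi> t \<theta>))) *\<^sub>R frT t \<theta>) +
      ((s * f1 t \<theta>) *\<^sub>R (- kap t *\<^sub>R frT t \<theta>) + (s * f11 t \<theta>) *\<^sub>R frN t \<theta>)) (at t within I)"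
      unfolding A_def
      by (intro has_vector_derivative_add has_vector_derivative_scaleR frT_deriv frN_deriv
          DERIV_diff DERIV_mult DERIV_cmult d1[OF t] d11[OF t]
          has_field_derivative_at_within[OF prof_deriv] has_field_derivative_at_within[OF kap_deriv])
    \<comment> \<open>The formula \<open>Yt\<close> for the inner derivative is known only on
      \<open>I\<close>; that suffices because the outer derivative is taken within \<open>I\<close>
      too.\<close>
    from has_vector_derivative_transform[OF t Yt this]
    show ?thesis unfolding partial_t_def[of I "partial_t I (Y s)"]
      by (subst vector_derivative_within[OF I[OF t]], assumption)
         (simp add: qn_def vec_eq_iff algebra_simps)
  qed
  have Yth: "partial_th (partial_t I (Y s)) t \<theta> =
      (- s * f2 t \<theta> * kap t) *\<^sub>R frT t \<theta> + (A s t \<theta> * qn t - s * f1 t \<theta> * dn t) *\<^sub>R frH \<theta>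
      + (s * f12 t \<theta>) *\<^sub>R frN t \<theta>" for s
  proof -
    have dA: "((\<lambda>\<theta>. A s t \<theta>) has_real_derivative - (s * f2 t \<theta> * kap t)) (at \<theta>)"
      unfolding A_def by (rule derivative_eq_intros d2[OF t] refl | simp)+
    have "((\<lambda>r. A s t r *\<^sub>R frT t r + (s * f1 t r) *\<^sub>R frN t r) has_vector_derivative
      (A s t \<theta> *\<^sub>R (qn t *\<^sub>R frH \<theta>) + (- (s * f2 t \<theta> * kap t)) *\<^sub>R frT t \<theta>) +
      ((s * f1 t \<theta>) *\<^sub>R (- dn t *\<^sub>R frH \<theta>) + (s * f12 t \<theta>) *\<^sub>R frN t \<theta>)) (at \<theta>)"
      by (intro has_vector_derivative_add has_vector_derivative_scaleR frT_deriv_th frN_deriv_th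
          DERIV_cmult d12[OF t] dA)
    then show ?thesis unfolding partial_th_def Yt[OF t]
      by (subst vector_derivative_at, assumption) (simp add: algebra_simps)
  qed
  have Yhh: "partial_th (partial_th (Y s)) t \<theta> =
      (- B s t \<theta> * qn t) *\<^sub>R frT t \<theta> + (- 2 * s * f2 t \<theta> * dn t) *\<^sub>R frH \<theta>
      + (B s t \<theta> * dn t + s * f22 t \<theta>) *\<^sub>R frN t \<theta>" for s
  proof -
    have dB: "((\<lambda>\<theta>. B s t \<theta>) has_real_derivative - (s * f2 t \<theta> * dn t)) (at \<theta>)"
      unfolding B_def by (rule derivative_eq_intros d2[OF t] refl | simp)+
    have "((\<lambda>r. B s t r *\<^sub>R frH r + (s * f2 t r) *\<^sub>R frN t r) has_vector_derivative
      (B s t \<theta> *\<^sub>R (- (qn t *\<^sub>R frT t \<theta>) + dn t *\<^sub>R frN t \<theta>) + (- (s * f2 t \<theta> * dn t)) *\<^sub>R frH \<theta>) +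
      ((s * f2 t \<theta>) *\<^sub>R (- dn t *\<^sub>R frH \<theta>) + (s * f22 t \<theta>) *\<^sub>R frN t \<theta>)) (at \<theta>)"
      by (intro has_vector_derivative_add has_vector_derivative_scaleR frH_deriv_th frN_deriv_th
          DERIV_cmult d22[OF t] dB)
    then show ?thesis unfolding partial_th_def[of "partial_th (Y s)"] Yh[OF t]
      by (subst vector_derivative_at, assumption) (simp add: vec_eq_iff algebra_simps)
  qed
  note H = frame_mean_curvature_deriv[where x="prof t" and k="kap t" and d="dn t" and q="qn t"
      and u="\<phi> t \<theta>" and ut="f1 t \<theta>" and uh="f2 t \<theta>" and utt="f11 t \<theta>" and uth="f12 t \<theta>"
      and uhh="f22 t \<theta>" and l="- b * sn t * dn t", OF prof_pos]
  have kd: "kap t + dn t = 2 * prof t" by (simp add: kap_def dn_def)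
  have "((\<lambda>s. mean_curv I (Y s) t \<theta>) has_real_derivative
      (f11 t \<theta> + f22 t \<theta> + ((kap t)\<^sup>2 + (dn t)\<^sup>2) * \<phi> t \<theta>) / (2 * (prof t)\<^sup>2)) (at 0)"
    unfolding mean_curv_def unit_normal_def Let_def Yt[OF t] Yh[OF t] Ytt Yth Yhh
    unfolding mean_curvature_in_frame[OF frame_orthonormal frame_cross]
    using H[OF kd] unfolding A_def B_def .
  then have "deriv (\<lambda>s. mean_curv I (Y s) t \<theta>) 0 =
      (f11 t \<theta> + f22 t \<theta> + ((kap t)\<^sup>2 + (dn t)\<^sup>2) * \<phi> t \<theta>) / (2 * (prof t)\<^sup>2)"
    by (rule DERIV_imp_deriv)
  then show ?thesis
    unfolding jacobi_op_def unit_normal_surf Y_def by (simp add: kap_sq dn_sq)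
qed

end

section \<open>The modes\<close>

text \<open>Compose with the embeddings of the coordinate lines. A line in the angle lies entirely
  in the strip, so its derivative is two-sided even over an endpoint of \<open>I\<close>.\<close>

lemma has_gradient_on_slice:
  assumes "has_gradient_on (I \<times> UNIV) (\<lambda>(t, \<theta>). f t \<theta>) f1 f2" and t: "t \<in> I"
  shows "((\<lambda>t. f t \<theta>) has_real_derivative f1 (t, \<theta>)) (at t within I)"
    and "((\<lambda>\<theta>. f t \<theta>) has_real_derivative f2 (t, \<theta>)) (at \<theta>)"
proof -
  have d: "((\<lambda>(t, \<theta>). f t \<theta>) has_derivative (\<lambda>h. f1 (t, \<theta>) * fst h + f2 (t, \<theta>) * snd h))
      (at (t, \<theta>) within I \<times> UNIV)"
    using assms unfolding has_gradient_on_def by auto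
  have p1: "((\<lambda>t. (t, \<theta>)) has_derivative (\<lambda>h. (h, 0))) (at t within I)"
    by (rule derivative_eq_intros refl | simp)+
  have p2: "((\<lambda>\<theta>. (t, \<theta>)) has_derivative (\<lambda>h. (0, h))) (at \<theta> within UNIV)"
    by (rule derivative_eq_intros refl | simp)+
  have d1: "((\<lambda>(t, \<theta>). f t \<theta>) has_derivative (\<lambda>h. f1 (t, \<theta>) * fst h + f2 (t, \<theta>) * snd h))
      (at (t, \<theta>) within (\<lambda>t. (t, \<theta>)) ` I)"
    by (rule has_derivative_subset[OF d]) auto
  have d2: "((\<lambda>(t, \<theta>). f t \<theta>) has_derivative (\<lambda>h. f1 (t, \<theta>) * fst h + f2 (t, \<theta>) * snd h))
      (at (t, \<theta>) within (\<lambda>\<theta>. (t, \<theta>)) ` UNIV)"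
    by (rule has_derivative_subset[OF d]) (use t in auto)
  show "((\<lambda>t. f t \<theta>) has_real_derivative f1 (t, \<theta>)) (at t within I)"
    using has_derivative_in_compose[OF p1 d1] unfolding has_field_derivative_def by simp
  show "((\<lambda>\<theta>. f t \<theta>) has_real_derivative f2 (t, \<theta>)) (at \<theta>)"
    using has_derivative_in_compose[OF p2 d2] unfolding has_field_derivative_def by simp
qed

lemma has_gradient_on_mult:
  fixes g h :: "real \<Rightarrow> real"
  assumes g: "\<And>t. t \<in> I \<Longrightarrow> (g has_real_derivative g' t) (at t within I)"
    and h: "\<And>\<theta>. (h has_real_derivative h' \<theta>) (at \<theta>)"
  shows "has_gradient_on (I \<times> UNIV) (\<lambda>(t, \<theta>). g t * h \<theta>) (\<lambda>(t, \<theta>). g' t * h \<theta>) (\<lambda>(t, \<theta>). g t * h' \<theta>)"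
  unfolding has_gradient_on_def
proof (clarify, goal_cases)
  case (1 t \<theta>)
  have g': "(g has_derivative (\<lambda>x. g' t * x)) (at (fst (t, \<theta>)) within fst ` (I \<times> (UNIV :: real set)))"
    using g[OF 1(1)] by (simp add: has_field_derivative_def)
  have h': "(h has_derivative (\<lambda>x. h' \<theta> * x)) (at (snd (t, \<theta>)) within snd ` (I \<times> (UNIV :: real set)))"
    using h[of \<theta>] by (auto simp: has_field_derivative_def intro: has_derivative_at_withinI)
  have f: "(fst has_derivative fst) (at (t, \<theta>) within I \<times> (UNIV :: real set))"
    and s: "(snd has_derivative snd) (at (t, \<theta>) within I \<times> (UNIV :: real set))"
    by (rule derivative_eq_intros refl)+
  have "((\<lambda>x. g (fst x) * h (snd x)) has_derivative
      (\<lambda>x. g (fst (t, \<theta>)) * (h' \<theta> * snd x) + g' t * fst x * h (snd (t, \<theta>))))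
      (at (t, \<theta>) within I \<times> UNIV)"
    by (rule has_derivative_mult[OF has_derivative_in_compose[OF f g']
          has_derivative_in_compose[OF s h']])
  then show ?case by (simp add: case_prod_unfold algebra_simps)
qed

lemma DERIV_cos_mult: "((\<lambda>\<theta>. cos (m * \<theta>)) has_real_derivative - (m * sin (m * \<theta>))) (at \<theta>)"
  and DERIV_sin_mult: "((\<lambda>\<theta>. - (m * sin (m * \<theta>))) has_real_derivative - (m\<^sup>2 * cos (m * \<theta>))) (at \<theta>)"
  by (rule derivative_eq_intros refl | simp add: power2_eq_square)+

context delaunay_param
begin

lemma jacobi_op_C2:
  assumes I: "\<And>t. t \<in> I \<Longrightarrow> at t within I \<noteq> bot"
    and "has_gradient_on (I \<times> UNIV) (\<lambda>(t, \<theta>). \<phi> t \<theta>) f1 f2"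
    and "has_gradient_on (I \<times> UNIV) f1 f11 f12"
    and "has_gradient_on (I \<times> UNIV) f2 f21 f22"
    and t: "t \<in> I"
  shows "jacobi_op a I \<phi> t \<theta> =
    (f11 (t, \<theta>) + f22 (t, \<theta>) + 2 * pot t * \<phi> t \<theta>) / (2 * (prof t)\<^sup>2)"
proof -
  have c: "(\<lambda>(t, \<theta>). f (t, \<theta>)) = f" for f :: "real \<times> real \<Rightarrow> real" by auto
  note s = has_gradient_on_slice[OF assms(2)]
    has_gradient_on_slice[where f="\<lambda>t \<theta>. f1 (t, \<theta>)", unfolded c, OF assms(3)]
    has_gradient_on_slice[where f="\<lambda>t \<theta>. f2 (t, \<theta>)", unfolded c, OF assms(4)]
  show ?thesis
    by (rule jacobi_op_eq[where ?f1.0="\<lambda>t \<theta>. f1 (t, \<theta>)" and ?f2.0="\<lambda>t \<theta>. f2 (t, \<theta>)"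
          and ?f11.0="\<lambda>t \<theta>. f11 (t, \<theta>)" and ?f12.0="\<lambda>t \<theta>. f12 (t, \<theta>)"
          and ?f22.0="\<lambda>t \<theta>. f22 (t, \<theta>)", OF I _ _ _ _ _ t])
       (use s in auto)
qed

text \<open>Separation of variables leads to w'' = (j^2 - 2p) w. Since p is even, the even solutions
  form a line; this is its generator, normalized at 0, and the degenerate parameters will be its
  positive zeros.\<close>

definition mode_solution :: "nat \<Rightarrow> (real \<Rightarrow> real) \<Rightarrow> (real \<Rightarrow> real) \<Rightarrow> bool" where
  "mode_solution j w v \<longleftrightarrow> (\<forall>t. (w has_real_derivative v t) (at t)) \<and>
     (\<forall>t. (v has_real_derivative ((real j)\<^sup>2 - 2 * pot t) * w t) (at t)) \<and> w 0 = 1 \<and> v 0 = 0"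

lemma mode_solutionD:
  assumes "mode_solution j w v"
  shows "(w has_real_derivative v t) (at t within S)"
    "(v has_real_derivative ((real j)\<^sup>2 - 2 * pot t) * w t) (at t within S)" "w 0 = 1" "v 0 = 0"
  using assms by (simp_all add: mode_solution_def has_field_derivative_at_within)

lemma mode_solution_exists: "\<exists>w v. mode_solution j w v"
proof -
  have "continuous_on UNIV (\<lambda>t. (real j)\<^sup>2 - 2 * pot t)"
    by (intro continuous_intros)
  then show ?thesis
    by (rule linear_ode_exists) (auto simp: mode_solution_def)
qed

text \<open>Evenness is used only through the vanishing derivative at 0. As a statement on [-T,T] it
  covers Fourier coefficients of functions in \<open>space_X\<close> as well as modes on the whole
  line.\<close>

lemma mode_solution_unique:
  assumes m: "mode_solution j w v"
    and u: "\<And>t. t \<in> {-T..T} \<Longrightarrow> (u has_real_derivative u' t) (at t within {-T..T})"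
    and u': "\<And>t. t \<in> {-T..T} \<Longrightarrow>
      (u' has_real_derivative ((real j)\<^sup>2 - 2 * pot t) * u t) (at t within {-T..T})"
    and "u' 0 = 0" and "t \<in> {-T..T}"
  shows "u t = u 0 * w t"
proof (rule linear_ode_unique[OF u u' mode_solutionD(1,2)[OF m]])
  show "continuous_on {-T..T} (\<lambda>t. (real j)\<^sup>2 - 2 * pot t)"
    by (intro continuous_intros)
qed (use assms mode_solutionD(3,4)[OF m] in auto)

lemma mode_solution_even:
  assumes m: "mode_solution j w v"
  shows "w (- t) = w t"
proof -
  have "w (- t) = w (- 0) * w t"
  proof (rule mode_solution_unique[OF m, where u="\<lambda>t. w (- t)" and u'="\<lambda>t. - v (- t)" and T="\<bar>t\<bar>"])
    fix t
    show "((\<lambda>t. w (- t)) has_real_derivative - v (- t)) (at t within {-T..T})" for T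
      using mode_solutionD(1)[OF m, of "- t" UNIV, unfolded DERIV_mirror]
      by (rule has_field_derivative_at_within)
    show "((\<lambda>t. - v (- t)) has_real_derivative ((real j)\<^sup>2 - 2 * pot t) * w (- t)) (at t within {-T..T})" for T
      using DERIV_minus[OF mode_solutionD(2)[OF m, of "- t" UNIV, unfolded DERIV_mirror]]
      by (simp add: pot_even has_field_derivative_at_within)
  qed (use mode_solutionD(3,4)[OF m] in auto)
  then show ?thesis using mode_solutionD(3)[OF m] by simp
qed

lemma mode_gradients:
  assumes m: "mode_solution j w v"
  defines "p \<equiv> \<lambda>t. ((real j)\<^sup>2 - 2 * pot t) * w t"
  shows "has_gradient_on (I \<times> UNIV) (\<lambda>(t, \<theta>). w t * cos (real j * \<theta>))
      (\<lambda>(t, \<theta>). v t * cos (real j * \<theta>)) (\<lambda>(t, \<theta>). w t * - (real j * sin (real j * \<theta>)))"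
    and "has_gradient_on (I \<times> UNIV) (\<lambda>(t, \<theta>). v t * cos (real j * \<theta>))
      (\<lambda>(t, \<theta>). p t * cos (real j * \<theta>)) (\<lambda>(t, \<theta>). v t * - (real j * sin (real j * \<theta>)))"
    and "has_gradient_on (I \<times> UNIV) (\<lambda>(t, \<theta>). w t * - (real j * sin (real j * \<theta>)))
      (\<lambda>(t, \<theta>). v t * - (real j * sin (real j * \<theta>)))
      (\<lambda>(t, \<theta>). w t * - ((real j)\<^sup>2 * cos (real j * \<theta>)))"
  unfolding p_def
  by (intro has_gradient_on_mult mode_solutionD[OF m] DERIV_cos_mult DERIV_sin_mult)+

text \<open>\<open>P\<close> is left open to serve both function spaces: continuity for
  \<open>C2_cyl\<close> and the Hoelder condition for \<open>C2_holder_cyl\<close>.\<close>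

lemma mode_second_derivs:
  assumes m: "mode_solution j w v"
    and P: "P (\<lambda>(t, \<theta>). ((real j)\<^sup>2 - 2 * pot t) * w t * cos (real j * \<theta>))"
      "P (\<lambda>(t, \<theta>). v t * - (real j * sin (real j * \<theta>)))"
      "P (\<lambda>(t, \<theta>). w t * - ((real j)\<^sup>2 * cos (real j * \<theta>)))"
  shows "second_derivs_on (I \<times> UNIV) P (\<lambda>(t, \<theta>). w t * cos (real j * \<theta>))"
  unfolding second_derivs_on_def using mode_gradients[OF m, of I] P by blast

lemma mode_jacobi_op:
  assumes m: "mode_solution j w v" and I: "\<And>t. t \<in> I \<Longrightarrow> at t within I \<noteq> bot" and t: "t \<in> I"
  shows "jacobi_op a I (\<lambda>t \<theta>. w t * cos (real j * \<theta>)) t \<theta> = 0"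
  by (subst jacobi_op_C2[OF I mode_gradients[OF m] t]) (simp_all add: algebra_simps)

lemma mode_continuous:
  assumes m: "mode_solution j w v"
  shows "continuous_on S w" "continuous_on S v"
  using DERIV_continuous_on[OF mode_solutionD(1)[OF m]] DERIV_continuous_on[OF mode_solutionD(2)[OF m]]
  by auto

lemma cos_periodic_nat: "cos (real j * (\<theta> + 2 * pi)) = cos (real j * \<theta>)"
proof -
  have "real j * (\<theta> + 2 * pi) = real j * \<theta> + of_int (int j) * (2 * pi)"
    by (simp add: algebra_simps)
  then show ?thesis
    using cos_int_2pin[of "int j"] sin_int_2pin[of "int j"] by (simp add: cos_add mult_ac)
qed

text \<open>The radial factor of an admissible mode is an even solution, hence a nonzero multiple of
  the normalized one, and the boundary condition at angle 0 says that it vanishes at T.\<close>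

lemma degen_mode_eq:
  assumes m: "mode_solution j w v"
  shows "degen_mode a j = {T. T > 0 \<and> w T = 0}"
proof (intro set_eqI iffI)
  fix T assume "T \<in> degen_mode a j"
  then obtain \<phi> u where T: "T > 0" and C2: "C2_cyl UNIV \<phi>" and nz: "\<exists>t \<theta>. \<phi> t \<theta> \<noteq> 0"
    and \<phi>: "\<And>t \<theta>. \<phi> t \<theta> = u t * cos (real j * \<theta>)" and ev: "\<And>t. u (- t) = u t"
    and J: "\<And>t \<theta>. jacobi_op a UNIV \<phi> t \<theta> = 0" and Tz: "\<And>\<theta>. \<phi> T \<theta> = 0"
    unfolding degen_mode_def by blast
  obtain f1 f2 f11 f12 f21 f22 where g:
      "has_gradient_on (UNIV \<times> UNIV) (\<lambda>(t, \<theta>). \<phi> t \<theta>) f1 f2"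
      "has_gradient_on (UNIV \<times> UNIV) (\<lambda>(t, \<theta>). f1 (t, \<theta>)) f11 f12"
      "has_gradient_on (UNIV \<times> UNIV) (\<lambda>(t, \<theta>). f2 (t, \<theta>)) f21 f22"
    using C2 unfolding C2_cyl_def second_derivs_on_def by auto
  note s = has_gradient_on_slice[OF g(1) UNIV_I] has_gradient_on_slice[OF g(2) UNIV_I]
    has_gradient_on_slice[OF g(3) UNIV_I]
  \<comment> \<open>At angle 0 the cosine is 1, so \<open>u\<close>, on which no regularity is
    imposed, inherits its derivatives from \<phi>.\<close>
  have u: "(u has_real_derivative f1 (t, 0)) (at t)" for t
    using s(1)[of 0 t] by (simp add: \<phi>)
  have f2: "f2 (t, \<theta>) = u t * - (real j * sin (real j * \<theta>))" for t \<theta>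
    by (rule DERIV_unique[OF s(2)[of t \<theta>, unfolded \<phi>] DERIV_cmult[OF DERIV_cos_mult]])
  have f22: "f22 (t, 0) = u t * - ((real j)\<^sup>2 * cos (real j * 0))" for t
    by (rule DERIV_unique[OF s(6)[of t 0, unfolded f2] DERIV_cmult[OF DERIV_sin_mult]])
  have f11: "f11 (t, 0) = ((real j)\<^sup>2 - 2 * pot t) * u t" for t
  proof -
    have c: "(\<lambda>(t, \<theta>). f (t, \<theta>)) = f" for f :: "real \<times> real \<Rightarrow> real" by auto
    have "jacobi_op a UNIV \<phi> t 0 = (f11 (t, 0) + f22 (t, 0) + 2 * pot t * \<phi> t 0) / (2 * (prof t)\<^sup>2)"
      by (rule jacobi_op_C2[OF _ g(1) g(2)[unfolded c] g(3)[unfolded c]]) auto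
    then show ?thesis
      using J[of t 0] prof_nz[of t] f22[of t] by (simp add: \<phi> algebra_simps)
  qed
  have u0: "f1 (0, 0) = 0"
  proof -
    have "((\<lambda>t. u (- t)) has_real_derivative - f1 (0, 0)) (at 0)"
      using u[of "- 0"] unfolding DERIV_mirror by simp
    then have "(u has_real_derivative - f1 (0, 0)) (at 0)" by (simp add: ev)
    from DERIV_unique[OF this u] show ?thesis by simp
  qed
  have eq: "u t = u 0 * w t" for t
    by (rule mode_solution_unique[OF m, where u'="\<lambda>t. f1 (t, 0)" and T="\<bar>t\<bar>"])
       (use u u0 s(3)[of 0] f11 in \<open>simp_all add: has_field_derivative_at_within, linarith?\<close>)
  have "u 0 \<noteq> 0" using nz unfolding \<phi> by (metis eq mult_zero_left)
  moreover have "u T = 0" using Tz[of 0] by (simp add: \<phi>)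
  ultimately show "T \<in> {T. T > 0 \<and> w T = 0}" using T eq[of T] by simp
next
  fix T assume T: "T \<in> {T. T > 0 \<and> w T = 0}"
  define \<phi> where "\<phi> = (\<lambda>t \<theta>. w t * cos (real j * \<theta>))"
  have cm: "continuous_on (UNIV \<times> UNIV) (\<lambda>(t, \<theta>). g t * h \<theta>)"
    if "continuous_on UNIV g" "continuous_on UNIV h" for g h :: "real \<Rightarrow> real"
    unfolding case_prod_unfold
    by (intro continuous_intros continuous_on_compose2[OF that(1)] continuous_on_compose2[OF that(2)]) auto
  have "C2_cyl UNIV \<phi>"
    unfolding C2_cyl_def \<phi>_def
    by (intro conjI mode_second_derivs[OF m] cm continuous_intros mode_continuous[OF m])
       (simp add: cos_periodic_nat)
  moreover have "\<exists>t \<theta>. \<phi> t \<theta> \<noteq> 0"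
    using mode_solutionD(3)[OF m] by (intro exI[of _ 0]) (simp add: \<phi>_def)
  moreover have "jacobi_op a UNIV \<phi> t \<theta> = 0" for t \<theta>
    unfolding \<phi>_def by (rule mode_jacobi_op[OF m]) auto
  ultimately show "T \<in> degen_mode a j"
    using T mode_solution_even[OF m] unfolding degen_mode_def mem_Collect_eq
    by (intro conjI exI[of _ \<phi>] exI[of _ w]) (simp_all add: \<phi>_def)
qed

section \<open>Sturm comparison\<close>

lemma mode_wronskian:
  assumes m: "mode_solution j w v"
    and V: "(V has_real_derivative V' t) (at t)" "(V' has_real_derivative (l - 2 * pot t) * V t) (at t)"
  shows "((\<lambda>t. v t * V t - w t * V' t) has_real_derivative ((real j)\<^sup>2 - l) * w t * V t) (at t)"
  by (rule derivative_eq_intros mode_solutionD[OF m] V refl | simp add: algebra_simps)+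

text \<open>The derivative of w/V is the Wronskian over V^2, and in the derivative of the Wronskian
  the potential cancels and only the eigenvalue gap j^2 - l remains. Every comparison below combines
  these two facts.\<close>

lemma mode_quotient:
  assumes m: "mode_solution j w v"
    and V: "(V has_real_derivative V1) (at t)" "V t \<noteq> 0"
  shows "((\<lambda>t. w t / V t) has_real_derivative (v t * V t - w t * V1) / (V t)\<^sup>2) (at t)"
  by (rule derivative_eq_intros mode_solutionD[OF m] V refl | simp add: power2_eq_square)+

text \<open>Sturm comparison: for the quotient \<open>u = w / V\<close>, the function \<open>V\<^sup>2 u u'\<close> is nondecreasing and
  vanishes at \<open>0\<close>, so \<open>u\<^sup>2\<close> is nondecreasing.\<close>

lemma mode_nonzero:
  assumes m: "mode_solution j w v"
    and V: "\<And>t. (V has_real_derivative V' t) (at t)"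
      "\<And>t. (V' has_real_derivative (l - 2 * pot t) * V t) (at t)"
    and pos: "\<And>t. V t > 0" and V0: "V' 0 = 0" and l: "l \<le> (real j)\<^sup>2" and T: "T \<ge> 0"
  shows "w T \<noteq> 0"
proof -
  have nz: "V t \<noteq> 0" for t using pos[of t] by simp
  define R where "R t = v t * V t - w t * V' t" for t
  define u where "u t = w t / V t" for t
  have dR: "(R has_real_derivative ((real j)\<^sup>2 - l) * w t * V t) (at t)" for t
    unfolding R_def by (rule mode_wronskian[OF m V])
  have du: "(u has_real_derivative R t / (V t)\<^sup>2) (at t)" for t
    unfolding R_def u_def by (rule mode_quotient[OF m V(1) nz])
  have G: "0 \<le> u r * R r" if "r \<ge> 0" for r
  proof -
    have "u 0 * R 0 \<le> u r * R r"
    proof (rule DERIV_nonneg_imp_nondecreasing[OF that])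
      fix t
      have "((\<lambda>t. u t * R t) has_real_derivative
          u t * (((real j)\<^sup>2 - l) * w t * V t) + R t / (V t)\<^sup>2 * R t) (at t)"
        by (rule DERIV_mult'[OF du dR])
      moreover have "u t * (((real j)\<^sup>2 - l) * w t * V t) = ((real j)\<^sup>2 - l) * (w t)\<^sup>2"
        using nz[of t] by (simp add: u_def power2_eq_square)
      then have "0 \<le> u t * (((real j)\<^sup>2 - l) * w t * V t)" using l by (simp only: zero_le_power2 mult_nonneg_nonneg diff_ge_0_iff_ge)
      moreover have "0 \<le> R t / (V t)\<^sup>2 * R t" by simp
      ultimately show "\<exists>y. ((\<lambda>t. u t * R t) has_real_derivative y) (at t) \<and> 0 \<le> y"
        by (intro exI[of _ "u t * (((real j)\<^sup>2 - l) * w t * V t) + R t / (V t)\<^sup>2 * R t"] conjI add_nonneg_nonneg)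
    qed
    moreover have "R 0 = 0" using mode_solutionD(3,4)[OF m] V0 by (simp add: R_def)
    ultimately show ?thesis by simp
  qed
  have "(u 0)\<^sup>2 \<le> (u T)\<^sup>2"
  proof (rule DERIV_nonneg_imp_nondecreasing[OF T])
    fix r assume r: "0 \<le> r" "r \<le> T"
    have "((\<lambda>t. (u t)\<^sup>2) has_real_derivative 2 * (u r * R r) / (V r)\<^sup>2) (at r)"
      by (rule derivative_eq_intros du refl | simp)+
    then show "\<exists>y. ((\<lambda>t. (u t)\<^sup>2) has_real_derivative y) (at r) \<and> 0 \<le> y"
      using G[OF r(1)] by (intro exI[of _ "2 * (u r * R r) / (V r)\<^sup>2"]) auto
  qed
  moreover have "u 0 \<noteq> 0" using mode_solutionD(3,4)[OF m] nz[of 0] by (simp add: u_def)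
  ultimately have "u T \<noteq> 0" by auto
  then show ?thesis by (simp add: u_def)
qed

lemma degen_mode_empty:
  assumes "\<And>t. (V has_real_derivative V' t) (at t)"
      "\<And>t. (V' has_real_derivative (l - 2 * pot t) * V t) (at t)"
    and "\<And>t. V t > 0" and "V' 0 = 0" and "l \<le> (real j)\<^sup>2"
  shows "degen_mode a j = {}"
proof -
  obtain w v where m: "mode_solution j w v" using mode_solution_exists by blast
  show ?thesis
    unfolding degen_mode_eq[OF m] using mode_nonzero[OF m assms] by auto
qed

text \<open>For a < 0 the constant gamma is negative, so z' = x^2 - gamma is positive. Hence
  \<open>dn\<close> = z'/x is a positive solution with eigenvalue 1, at most j^2.\<close>

lemma degen_mode_empty_neg:
  assumes "a < 0" and "j \<ge> 1"
  shows "degen_mode a j = {}"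
proof (rule degen_mode_empty[OF dn_deriv dn_deriv2])
  have "gam a < 0" using assms a_gt by (simp add: gam_def mult_neg_pos)
  then show "dn t > 0" for t
    using prof_pos[of t] by (simp add: dn_def) (smt (verit) divide_neg_pos)
  show "1 \<le> (real j)\<^sup>2" using assms by simp
qed (simp add: sn_0)

lemma gam_pos: "a > 0 \<Longrightarrow> gam a > 0"
  by (simp add: gam_def)

lemma kap_pos:
  assumes "a > 0"
  shows "kap t > 0"
  using prof_pos[of t] gam_pos[OF assms] by (simp add: kap_def add_pos_pos)

lemma degen_mode_empty_pos:
  assumes "a > 0" and "b \<le> real j"
  shows "degen_mode a j = {}"
proof (rule degen_mode_empty[OF kap_deriv kap_deriv2 kap_pos])
  show "b\<^sup>2 \<le> (real j)\<^sup>2"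
    using assms by (intro power_mono) (auto simp: b_def)
qed (use assms in \<open>auto simp: sn_0\<close>)

text \<open>Suppose w stays positive. Then its Wronskian with \<open>kap\<close> starts at 0,
  decreases strictly and stays below a negative constant. As \<open>kap\<close> is bounded, w / kap
  falls at least linearly and must become negative.\<close>

lemma degen_mode_nonempty:
  assumes a0: "a > 0" and j: "real j < b"
  shows "degen_mode a j \<noteq> {}"
proof
  assume empty: "degen_mode a j = {}"
  obtain w v where m: "mode_solution j w v" using mode_solution_exists by blast
  have wnz: "w t \<noteq> 0" if "t > 0" for t
    using empty that unfolding degen_mode_eq[OF m] by auto
  have wpos: "w t > 0" if "t \<ge> 0" for t
  proof (rule ccontr)
    assume n: "\<not> w t > 0"
    have "\<exists>x\<ge>0. x \<le> t \<and> w x = 0"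
      by (rule IVT2)
         (use n that mode_solutionD(3)[OF m] DERIV_isCont[OF mode_solutionD(1)[OF m]] in auto)
    then show False using wnz mode_solutionD(3)[OF m] by (metis less_eq_real_def zero_neq_one)
  qed
  note kp = kap_pos[OF a0]
  have knz: "kap t \<noteq> 0" for t using kp[of t] by simp
  define R where "R t = v t * kap t - w t * (- b * sn t * dn t)" for t
  have dR: "(R has_real_derivative ((real j)\<^sup>2 - b\<^sup>2) * w t * kap t) (at t)" for t
    unfolding R_def by (rule mode_wronskian[OF m kap_deriv kap_deriv2])
  have jb: "(real j)\<^sup>2 < b\<^sup>2" using j by (intro power_strict_mono) auto
  have Rneg: "R t < R s" if "0 \<le> s" "s < t" for s t
  proof (rule DERIV_neg_imp_decreasing[OF that(2)])
    fix r assume "s \<le> r" "r \<le> t"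
    then have "w r * kap r > 0" using wpos[of r] kp[of r] that by simp
    then have "((real j)\<^sup>2 - b\<^sup>2) * w r * kap r < 0"
      using jb by (simp add: mult.assoc mult_neg_pos)
    then show "\<exists>y. (R has_real_derivative y) (at r) \<and> y < 0" using dR by blast
  qed
  have "R 0 = 0" using mode_solutionD(3,4)[OF m] by (simp add: R_def sn_0)
  \<comment> \<open>Time 1 is an arbitrary positive time after which the Wronskian is bounded away
    from 0.\<close>
  define \<delta> where "\<delta> = - R 1"
  have \<delta>: "\<delta> > 0" using Rneg[of 0 1] \<open>R 0 = 0\<close> by (simp add: \<delta>_def)
  have R\<delta>: "R t \<le> - \<delta>" if "t \<ge> 1" for t
    using Rneg[of 1 t] that by (cases "t = 1") (auto simp: \<delta>_def)
  define K where "K = c + 2 * gam a"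
  have K: "(kap t)\<^sup>2 \<le> K" for t
    by (simp add: K_def kap_sq pot_eq)
  then have Kpos: "K > 0" using kp[of 0] by (smt (verit) zero_less_power)
  define u where "u t = w t / kap t" for t
  have du: "(u has_real_derivative R t / (kap t)\<^sup>2) (at t)" for t
    unfolding R_def u_def by (rule mode_quotient[OF m kap_deriv knz])
  \<comment> \<open>Chosen so that the linear bound of slope -\<delta>/K, started at time 1, brings
    \<open>u\<close> down to -1.\<close>
  define t where "t = 1 + (u 1 + 1) * K / \<delta>"
  have u1: "u 1 > 0" using wpos[of 1] kp[of 1] by (simp add: u_def)
  have t1: "t \<ge> 1" using u1 Kpos \<delta> by (simp add: t_def)
  have "u t + \<delta> / K * t \<le> u 1 + \<delta> / K * 1"
  proof (rule DERIV_nonpos_imp_nonincreasing[OF t1])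
    fix r assume r: "1 \<le> r" "r \<le> t"
    have "((\<lambda>t. u t + \<delta> / K * t) has_real_derivative R r / (kap r)\<^sup>2 + \<delta> / K * 1) (at r)"
      by (intro DERIV_add du DERIV_cmult DERIV_ident)
    moreover have "\<delta> / K \<le> \<delta> / (kap r)\<^sup>2"
      using K \<delta> kp[of r] Kpos by (intro divide_left_mono) auto
    moreover have "R r / (kap r)\<^sup>2 \<le> - \<delta> / (kap r)\<^sup>2"
      using R\<delta>[OF r(1)] by (intro divide_right_mono) auto
    ultimately show "\<exists>y. ((\<lambda>t. u t + \<delta> / K * t) has_real_derivative y) (at r) \<and> y \<le> 0"
      by (intro exI[of _ "R r / (kap r)\<^sup>2 + \<delta> / K * 1"]) auto
  qed
  moreover have "\<delta> / K * t = \<delta> / K * 1 + (u 1 + 1)"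
    using \<delta> Kpos by (simp add: t_def field_simps)
  ultimately have "u t \<le> -1" by simp
  moreover have "u t > 0" using wpos[of t] kp[of t] t1 by (simp add: u_def)
  ultimately show False by simp
qed

lemma mode_solution_1: "mode_solution 1 dn (\<lambda>t. - b * sn t * kap t)"
proof -
  have "dn 0 = 1" using a_gt by (simp add: dn_def prof_0 gam_def)
  then show ?thesis
    using dn_deriv dn_deriv2 by (simp add: mode_solution_def sn_0)
qed

text \<open>By \<open>b_dsn\<close> and positivity of \<open>kap\<close>, the zeros of
  \<open>dn\<close> are those of \<open>dsn\<close>, the critical points of
  \<open>sn\<close>.\<close>

lemma degen_mode_1:
  assumes "a > 0"
  shows "degen_mode a 1 = range (\<lambda>k::nat. (real k + 1/2) * tau)"
proof -
  have "dn t = 0 \<longleftrightarrow> dsn t = 0" for t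
    using b_dsn[of t] kap_pos[OF assms, of t] assms by (auto simp: b_def)
  then have "degen_mode a 1 = {T. T > 0 \<and> dsn T = 0}"
    unfolding degen_mode_eq[OF mode_solution_1] by simp
  also have "\<dots> = range (\<lambda>k::nat. (real k + 1/2) * tau)"
    using dsn_zero_iff tau_pos by (auto simp: less_imp_le)
  finally show ?thesis .
qed

section \<open>The rotationally symmetric mode\<close>

definition sn_sq_int :: "real \<Rightarrow> real" where
  "sn_sq_int = primitive (\<lambda>t. (sn t)\<^sup>2)"

lemma sn_sq_int_0: "sn_sq_int 0 = 0"
  and sn_sq_int_deriv: "(sn_sq_int has_real_derivative (sn t)\<^sup>2) (at t)"
  unfolding sn_sq_int_def by (rule primitive, intro continuous_intros)+

text \<open>Reduction of order from \<open>sn\<close>: because (sn'/sn)' = b^2 sn^2 - 1/sn^2, this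
  is - sn times a primitive of 1/sn^2, written so that the poles at the zeros of \<open>sn\<close>
  disappear.\<close>

definition w0 :: "real \<Rightarrow> real" where
  "w0 t = dsn t - b\<^sup>2 * (sn t * sn_sq_int t)"

definition v0 :: "real \<Rightarrow> real" where
  "v0 t = - 2 * pot t * sn t - b\<^sup>2 * (dsn t * sn_sq_int t + sn t ^ 3)"

lemma pot_deriv: "(pot has_real_derivative - 2 * b\<^sup>2 * sn t * dsn t) (at t)"
  unfolding pot_eq[abs_def]
  by (rule derivative_eq_intros sn_deriv refl | simp)+

lemma mode_solution_0: "mode_solution 0 w0 v0"
proof -
  have "(w0 has_real_derivative v0 t) (at t)" for t
    unfolding w0_def v0_def
    by (rule derivative_eq_intros sn_deriv dsn_deriv sn_sq_int_deriv refl)+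
       (simp add: algebra_simps power2_eq_square power3_eq_cube)
  moreover have "(v0 has_real_derivative - 2 * pot t * w0 t) (at t)" for t
    unfolding w0_def v0_def
    by (rule derivative_eq_intros sn_deriv dsn_deriv sn_sq_int_deriv pot_deriv refl)+
       (simp add: algebra_simps power2_eq_square power3_eq_cube)
  ultimately show ?thesis
    by (simp add: mode_solution_def w0_def[of 0] v0_def[of 0] sn_0 dsn_0 sn_sq_int_0)
qed

lemma sn_sq_int_pos:
  assumes "t \<ge> tau / 2"
  shows "sn_sq_int t > 0"
proof -
  have "sn_sq_int 0 < sn_sq_int (tau / 2)"
  proof (rule DERIV_pos_imp_increasing_open[where f=sn_sq_int])
    fix x assume "0 < x" "x < tau / 2"
    then have "sn x > 0" using tau_pos by (intro sn_pos) auto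
    then show "\<exists>y. (sn_sq_int has_real_derivative y) (at x) \<and> 0 < y"
      using sn_sq_int_deriv by (intro exI[of _ "(sn x)\<^sup>2"]) auto
  next
    show "continuous_on {0..tau / 2} sn_sq_int"
      by (rule DERIV_continuous_on[OF has_field_derivative_at_within[OF sn_sq_int_deriv]])
  qed (use tau_pos in auto)
  also have "\<dots> \<le> sn_sq_int t"
    by (rule DERIV_nonneg_imp_nondecreasing[OF assms]) (use sn_sq_int_deriv in fastforce)
  finally show ?thesis by (simp add: sn_sq_int_0)
qed

text \<open>A sign change between k tau, where \<open>w0\<close> is 1 up to sign, and (k + 1/2) tau,
  where \<open>dsn\<close> vanishes and only the integral term is left. That term carries the factor
  b^2: for b = 0 the zero is the right endpoint itself, hence the weak upper bound.\<close>

lemma w0_zero_exists: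
  fixes k :: nat
  shows "\<exists>T. real k * tau < T \<and> T \<le> (real k + 1/2) * tau \<and> w0 T = 0 \<and>
    (b \<noteq> 0 \<longrightarrow> T < (real k + 1/2) * tau)"
proof -
  \<comment> \<open>The sign undoes the antiperiodicity of \<open>sn\<close> and \<open>dsn\<close>,
    so that all k show the same pattern of signs.\<close>
  define h where "h t = (-1) ^ k * w0 t" for t
  have dh: "(h has_real_derivative (-1) ^ k * v0 t) (at t)" for t
    unfolding h_def by (rule DERIV_cmult[OF mode_solutionD(1)[OF mode_solution_0]])
  have half: "(real k + 1/2) * tau = tau / 2 + real k * tau" by (simp add: algebra_simps)
  have s: "sn (tau / 2) > 0" using tau_pos by (intro sn_pos) auto
  have h0: "h (real k * tau) = 1"
    using sn_shift_mult[of 0 k] dsn_shift_mult[of 0 k]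
    by (simp add: h_def w0_def sn_0 dsn_0 flip: power_mult_distrib)
  have h1: "h ((real k + 1/2) * tau) = - (b\<^sup>2 * (sn (tau / 2) * sn_sq_int ((real k + 1/2) * tau)))"
    using sn_shift_mult[of "tau / 2" k] dsn_shift_mult[of "tau / 2" k]
    by (simp add: h_def w0_def half dsn_half algebra_simps flip: power_mult_distrib)
  have S: "sn_sq_int ((real k + 1/2) * tau) > 0"
    using tau_pos by (intro sn_sq_int_pos) (simp add: half)
  have "\<exists>x\<ge>real k * tau. x \<le> (real k + 1/2) * tau \<and> h x = 0"
    by (rule IVT2) (use h0 h1 s S tau_pos DERIV_isCont[OF dh] in \<open>auto simp: algebra_simps\<close>)
  then obtain T where T: "real k * tau \<le> T" "T \<le> (real k + 1/2) * tau" "h T = 0" by blast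
  have "T \<noteq> real k * tau" using h0 T(3) by auto
  moreover have "T \<noteq> (real k + 1/2) * tau" if "b \<noteq> 0"
    using h1 T(3) s S that by auto
  moreover have "w0 T = 0" using T(3) by (simp add: h_def)
  ultimately show ?thesis using T by (intro exI[of _ T]) auto
qed

text \<open>The Wronskian of \<open>w0\<close> and the odd solution \<open>sn\<close> is \<open>-1\<close>, so \<open>w0 / sn\<close> decreases strictly
  between two zeros of \<open>sn\<close>.\<close>

lemma w0_zero_unique:
  fixes k :: nat
  assumes S: "real k * tau < S" and T: "T < (real k + 1) * tau" and ST: "S < T"
    and z: "w0 S = 0" "w0 T = 0"
  shows False
proof -
  define W where "W t = v0 t * sn t - w0 t * dsn t" for t
  have dsn2: "(dsn has_real_derivative (0 - 2 * pot t) * sn t) (at t)" for t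
    using dsn_deriv[of t] by simp
  have "(W has_real_derivative 0) (at t)" for t
    using mode_wronskian[OF mode_solution_0 sn_deriv dsn2] by (simp add: W_def[abs_def])
  then have "W t = W 0" for t using DERIV_isconst_all by blast
  then have W: "W t = -1" for t
    using mode_solutionD(3,4)[OF mode_solution_0] by (simp add: W_def[of 0] sn_0 dsn_0)
  have "w0 T / sn T < w0 S / sn S"
  proof (rule DERIV_neg_imp_decreasing[OF ST])
    fix r assume r: "S \<le> r" "r \<le> T"
    have "sn (r - real k * tau) > 0"
      using r S T by (intro sn_pos) (auto simp: algebra_simps)
    then have nz: "sn r \<noteq> 0"
      using sn_shift_mult[of "r - real k * tau" k] by simp
    have "((\<lambda>t. w0 t / sn t) has_real_derivative W r / (sn r)\<^sup>2) (at r)"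
      unfolding W_def by (rule mode_quotient[OF mode_solution_0 sn_deriv nz])
    then show "\<exists>y. ((\<lambda>t. w0 t / sn t) has_real_derivative y) (at r) \<and> y < 0"
      using nz by (intro exI[of _ "W r / (sn r)\<^sup>2"]) (simp add: W)
  qed
  then show False using z by simp
qed

text \<open>Each open interval between consecutive multiples of tau contains exactly one zero, and
  at the multiples themselves \<open>w0\<close> is 1 or -1. So the chosen zeros exhaust the positive
  ones and come in increasing order.\<close>

lemma degen_mode_0:
  "\<exists>T :: nat \<Rightarrow> real. strict_mono T \<and> degen_mode a 0 = range T \<and>
     (b \<noteq> 0 \<longrightarrow> (\<forall>k. T k \<in> {real k * tau<..<(real k + 1/2) * tau}))"
proof -
  obtain T :: "nat \<Rightarrow> real" where T: "\<And>k. real k * tau < T k" "\<And>k. T k \<le> (real k + 1/2) * tau"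
    "\<And>k. w0 (T k) = 0" "\<And>k. b \<noteq> 0 \<Longrightarrow> T k < (real k + 1/2) * tau"
    using w0_zero_exists by metis
  have up: "T k < (real k + 1) * tau" for k
    using T(2)[of k] tau_pos by (simp add: algebra_simps)
  have mono: "strict_mono T"
  proof (rule strict_monoI_Suc)
    show "T k < T (Suc k)" for k
      using up[of k] T(1)[of "Suc k"] by (simp add: algebra_simps)
  qed
  have pos: "T k > 0" for k
    using T(1)[of k] tau_pos by (smt (verit) mult_nonneg_nonneg of_nat_0_le_iff)
  have "t \<in> range T" if t: "t > 0" "w0 t = 0" for t
  proof -
    define k where "k = nat \<lfloor>t / tau\<rfloor>"
    have "real k = of_int \<lfloor>t / tau\<rfloor>" using t tau_pos by (simp add: k_def)
    then have "real k \<le> t / tau" "t / tau < real k + 1" by linarith+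
    then have k: "real k * tau \<le> t" "t < (real k + 1) * tau" using tau_pos by (auto simp: field_simps)
    have "t \<noteq> real k * tau"
    proof
      assume "t = real k * tau"
      then have "w0 t = (-1) ^ k"
        using sn_shift_mult[of 0 k] dsn_shift_mult[of 0 k] by (simp add: w0_def sn_0 dsn_0)
      then show False using t(2) by simp
    qed
    then have "t = T k"
      using w0_zero_unique[of k t "T k"] w0_zero_unique[of k "T k" t] k T(1,3)[of k] up[of k] t(2)
      by (cases "t < T k"; cases "T k < t") auto
    then show ?thesis by blast
  qed
  then have "degen_mode a 0 = range T"
    unfolding degen_mode_eq[OF mode_solution_0] using T(3) pos by auto
  then show ?thesis using mono T(1,4) by auto
qed

end

section \<open>Fourier expansion in the angle\<close>

text \<open>Membership in \<open>space_X\<close> speaks of Hoelder second derivatives;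
  differentiation of the Fourier coefficients under the integral sign uses their continuity.\<close>

lemma holder_on_imp_continuous_on:
  assumes "0 < \<alpha>" and "holder_on \<alpha> S f"
  shows "continuous_on S f"
  unfolding continuous_on_def
proof
  fix p assume p: "p \<in> S"
  obtain C where C: "\<And>p q. p \<in> S \<Longrightarrow> q \<in> S \<Longrightarrow> \<bar>f p - f q\<bar> \<le> C * dist p q powr \<alpha>"
    using assms(2) unfolding holder_on_def by blast
  have "((\<lambda>q. dist q p) \<longlongrightarrow> dist p p) (at p within S)"
    by (intro tendsto_intros)
  then have "((\<lambda>q. dist q p powr \<alpha>) \<longlongrightarrow> 0) (at p within S)"
    using assms(1) by (intro tendsto_zero_powrI[of _ _ "\<lambda>_. \<alpha>" \<alpha>]) auto
  then have lim: "((\<lambda>q. C * dist q p powr \<alpha>) \<longlongrightarrow> 0) (at p within S)"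
    by (rule tendsto_mult_right_zero)
  have "((\<lambda>q. f q - f p) \<longlongrightarrow> 0) (at p within S)"
  proof (rule Lim_null_comparison[OF _ lim])
    show "\<forall>\<^sub>F q in at p within S. norm (f q - f p) \<le> C * dist q p powr \<alpha>"
      unfolding eventually_at_filter using C p by (intro always_eventually) auto
  qed
  then show "(f \<longlongrightarrow> f p) (at p within S)"
    by (rule LIM_zero_cancel)
qed

lemma has_gradient_on_continuous_on:
  assumes "has_gradient_on S f f1 f2"
  shows "continuous_on S f"
  using assms unfolding has_gradient_on_def
  by (intro has_derivative_continuous_on[where f'="\<lambda>p h. f1 p * fst h + f2 p * snd h"]) blast

text \<open>The strip is unbounded in the angle, so a Lipschitz bound alone does not give the
  Hoelder bound. It is used for distances d <= 1, where d <= d^\<alpha>; for larger distances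
  boundedness of the product takes over.\<close>

lemma holder_on_mult:
  fixes g h :: "real \<Rightarrow> real"
  assumes \<alpha>: "0 < \<alpha>" "\<alpha> < 1"
    and g: "\<And>t. t \<in> {-T..T} \<Longrightarrow> (g has_real_derivative g' t) (at t within {-T..T})"
    and g': "continuous_on {-T..T} g'"
    and h: "\<And>\<theta>. (h has_real_derivative h' \<theta>) (at \<theta>)"
    and B: "\<And>\<theta>. \<bar>h \<theta>\<bar> \<le> B" "\<And>\<theta>. \<bar>h' \<theta>\<bar> \<le> B"
  shows "holder_on \<alpha> ({-T..T} \<times> UNIV) (\<lambda>(t, \<theta>). g t * h \<theta>)"
proof -
  obtain M where M: "\<And>t. t \<in> {-T..T} \<Longrightarrow> \<bar>g t\<bar> \<le> M"
    using continuous_on_Icc_bounded[OF DERIV_continuous_on[OF g]] by blast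
  obtain L where L: "\<And>t. t \<in> {-T..T} \<Longrightarrow> \<bar>g' t\<bar> \<le> L"
    using continuous_on_Icc_bounded[OF g'] by blast
  have gL: "\<bar>g t - g s\<bar> \<le> L * \<bar>t - s\<bar>" if "t \<in> {-T..T}" "s \<in> {-T..T}" for t s
    using field_differentiable_bound[OF _ g, of L t s] L that by auto
  have hL: "\<bar>h \<theta> - h \<eta>\<bar> \<le> B * \<bar>\<theta> - \<eta>\<bar>" for \<theta> \<eta>
    using field_differentiable_bound[OF convex_UNIV h, of B \<theta> \<eta>] B by auto
  have B0: "B \<ge> 0" using B(1)[of 0] by linarith
  define K where "K = L * B + M * B"
  have "\<bar>g t * h \<theta> - g s * h \<eta>\<bar> \<le> max K (2 * (M * B)) * dist (t, \<theta>) (s, \<eta>) powr \<alpha>"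
    if ts: "t \<in> {-T..T}" "s \<in> {-T..T}" for t s \<theta> \<eta>
  proof -
    define d where "d = dist (t, \<theta>) (s, \<eta>)"
    have M0: "M \<ge> 0" and L0: "L \<ge> 0" using M[OF ts(1)] L[OF ts(1)] by linarith+
    have td: "\<bar>t - s\<bar> \<le> d" and hd: "\<bar>\<theta> - \<eta>\<bar> \<le> d"
      using dist_fst_le[of "(t, \<theta>)" "(s, \<eta>)"] dist_snd_le[of "(t, \<theta>)" "(s, \<eta>)"]
      by (auto simp: d_def dist_real_def)
    have d0: "d \<ge> 0" by (simp add: d_def)
    have "\<bar>g t * h \<theta> - g s * h \<eta>\<bar> \<le> \<bar>g t - g s\<bar> * \<bar>h \<theta>\<bar> + \<bar>g s\<bar> * \<bar>h \<theta> - h \<eta>\<bar>"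
    proof -
      have "g t * h \<theta> - g s * h \<eta> = (g t - g s) * h \<theta> + g s * (h \<theta> - h \<eta>)"
        by (simp add: algebra_simps)
      then show ?thesis by (metis abs_mult abs_triangle_ineq)
    qed
    also have "\<dots> \<le> (L * \<bar>t - s\<bar>) * B + M * (B * \<bar>\<theta> - \<eta>\<bar>)"
      using gL[OF ts] B(1)[of \<theta>] M[OF ts(2)] hL[of \<theta> \<eta>] L0 M0 B0
      by (intro add_mono mult_mono) auto
    also have "\<dots> \<le> (L * d) * B + M * (B * d)"
      using td hd L0 M0 B0 by (intro add_mono mult_mono) auto
    finally have lip: "\<bar>g t * h \<theta> - g s * h \<eta>\<bar> \<le> K * d"
      by (simp add: K_def algebra_simps)
    have "\<bar>g t * h \<theta>\<bar> \<le> M * B" "\<bar>g s * h \<eta>\<bar> \<le> M * B"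
      unfolding abs_mult using M ts B(1) M0 B0 by (intro mult_mono; auto)+
    then have bd: "\<bar>g t * h \<theta> - g s * h \<eta>\<bar> \<le> 2 * (M * B)" by linarith
    show ?thesis
    proof (cases "d \<le> 1")
      case True
      have "d \<le> d powr \<alpha>"
        using powr_mono'[of \<alpha> 1 d] True d0 \<alpha> by (cases "d = 0") auto
      then have "K * d \<le> max K (2 * (M * B)) * d powr \<alpha>"
        using d0 M0 B0 by (intro mult_mono) (auto simp: le_max_iff_disj)
      then show ?thesis using lip unfolding d_def by linarith
    next
      case False
      then have "1 \<le> d powr \<alpha>" using \<alpha> by (intro ge_one_powr_ge_zero) auto
      then have "2 * (M * B) * 1 \<le> max K (2 * (M * B)) * d powr \<alpha>"
        using M0 B0 by (intro mult_mono) (auto simp: le_max_iff_disj)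
      then show ?thesis using bd unfolding d_def by linarith
    qed
  qed
  then show ?thesis unfolding holder_on_def by (intro exI[of _ "max K (2 * (M * B))"]) auto
qed

text \<open>Induction on the power of cosine, for all frequencies at once, through 2 cos \<theta>
  cos (j \<theta>) = cos ((j+1) \<theta>) + cos ((j-1) \<theta>). The frequency 0 is separate
  because it has no predecessor.\<close>

lemma cos_moments_zero:
  fixes g :: "real \<Rightarrow> real"
  assumes g: "continuous_on {0..pi} g"
    and z: "\<And>j::nat. integral {0..pi} (\<lambda>\<theta>. g \<theta> * cos (real j * \<theta>)) = 0"
  shows "integral {0..pi} (\<lambda>\<theta>. g \<theta> * cos \<theta> ^ n * cos (real j * \<theta>)) = 0"
proof (induction n arbitrary: j)
  case 0
  then show ?case using z by simp
next
  case (Suc n)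
  have int: "(\<lambda>\<theta>. g \<theta> * cos \<theta> ^ n * cos (real i * \<theta>)) integrable_on {0..pi}" for i
    by (intro integrable_continuous_real continuous_intros g)
  show ?case
  proof (cases j)
    case 0
    then show ?thesis using Suc[of 1] by (simp add: mult_ac)
  next
    case (Suc i)
    have "cos \<theta> * cos (real j * \<theta>) = (cos (real (Suc j) * \<theta>) + cos (real i * \<theta>)) / 2" for \<theta>
    proof -
      have "real (Suc j) * \<theta> = \<theta> + real j * \<theta>" "real i * \<theta> = real j * \<theta> - \<theta>"
        by (simp_all add: Suc algebra_simps)
      then show ?thesis by (simp add: cos_add cos_diff)
    qed
    moreover have "g \<theta> * cos \<theta> ^ Suc n * cos (real j * \<theta>) =
        g \<theta> * cos \<theta> ^ n * (cos \<theta> * cos (real j * \<theta>))" for \<theta>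
      by simp
    ultimately have "g \<theta> * cos \<theta> ^ Suc n * cos (real j * \<theta>) =
        g \<theta> * cos \<theta> ^ n * cos (real (Suc j) * \<theta>) / 2 + g \<theta> * cos \<theta> ^ n * cos (real i * \<theta>) / 2" for \<theta>
      by (simp only: distrib_left add_divide_distrib times_divide_eq_right)
    then show ?thesis
      using Suc.IH[of "Suc j"] Suc.IH[of i] int[of "Suc j"] int[of i]
      by (simp add: integral_add integrable_on_divide integral_divide del: power_Suc)
  qed
qed

text \<open>Weierstrass approximation in the variable \<open>cos \<theta>\<close> makes the cosine system complete.\<close>

lemma cos_coefficients_zero:
  fixes g :: "real \<Rightarrow> real"
  assumes g: "continuous_on {0..pi} g"
    and z: "\<And>j::nat. integral {0..pi} (\<lambda>\<theta>. g \<theta> * cos (real j * \<theta>)) = 0"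
    and \<theta>: "\<theta> \<in> {0..pi}"
  shows "g \<theta> = 0"
proof -
  obtain M where M: "\<And>\<theta>. \<theta> \<in> {0..pi} \<Longrightarrow> \<bar>g \<theta>\<bar> \<le> M"
    using continuous_on_Icc_bounded[OF g] by blast
  have M0: "M \<ge> 0" using M[OF \<theta>] by linarith
  let ?J = "integral {0..pi} (\<lambda>\<theta>. g \<theta> * g \<theta>)"
  have J: "?J \<le> e * (M * pi)" if e: "e > 0" for e
  proof -
    \<comment> \<open>The cosine maps [0,pi] bijectively onto [-1,1]; through its inverse,
      \<open>g\<close> becomes a continuous function of cos \<theta>.\<close>
    have "continuous_on {-1..1} (\<lambda>y. g (arccos y))"
      by (rule continuous_on_compose2[OF g continuous_on_arccos'])
         (auto simp: arccos_lbound arccos_ubound)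
    then obtain P where "real_polynomial_function P"
      and P: "\<And>y. y \<in> {-1..1} \<Longrightarrow> \<bar>g (arccos y) - P y\<bar> < e"
      using Stone_Weierstrass_real_polynomial_function[OF compact_Icc _ e] by metis
    then obtain co n where Peq: "P = (\<lambda>y. \<Sum>i\<le>n. co i * y ^ i)"
      unfolding real_polynomial_function_iff_sum by blast
    have gP: "\<bar>g r - P (cos r)\<bar> < e" if "r \<in> {0..pi}" for r
      using P[of "cos r"] that by (simp add: arccos_cos)
    have cP: "continuous_on {0..pi} (\<lambda>\<theta>. P (cos \<theta>))"
      unfolding Peq by (intro continuous_intros)
    have "integral {0..pi} (\<lambda>\<theta>. g \<theta> * P (cos \<theta>)) =
        integral {0..pi} (\<lambda>\<theta>. \<Sum>i\<le>n. co i * (g \<theta> * cos \<theta> ^ i))"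
      unfolding Peq by (simp add: sum_distrib_left mult_ac)
    also have "\<dots> = (\<Sum>i\<le>n. integral {0..pi} (\<lambda>\<theta>. co i * (g \<theta> * cos \<theta> ^ i)))"
      by (intro integral_sum integrable_continuous_real continuous_intros g) auto
    also have "\<dots> = 0"
      using cos_moments_zero[OF g z, of _ 0] by (intro sum.neutral) simp
    finally have P0: "integral {0..pi} (\<lambda>\<theta>. g \<theta> * P (cos \<theta>)) = 0" .
    \<comment> \<open>Orthogonality to P (cos \<theta>) allows one factor \<open>g\<close> of the
      square to be replaced by the error g - P (cos \<theta>), which is smaller than
      \<open>e\<close>.\<close>
    have "?J = ?J - integral {0..pi} (\<lambda>\<theta>. g \<theta> * P (cos \<theta>))" by (simp add: P0)
    also have "\<dots> = integral {0..pi} (\<lambda>\<theta>. g \<theta> * g \<theta> - g \<theta> * P (cos \<theta>))"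
      by (intro integral_diff[symmetric] integrable_continuous_real continuous_intros g cP)
    also have "\<dots> \<le> integral {0..pi} (\<lambda>\<theta>. M * e)"
    proof (rule integral_le)
      show "(\<lambda>\<theta>. g \<theta> * g \<theta> - g \<theta> * P (cos \<theta>)) integrable_on {0..pi}"
        by (intro integrable_continuous_real continuous_intros g cP)
      fix r assume r: "r \<in> {0..pi}"
      have "\<bar>g r\<bar> * \<bar>g r - P (cos r)\<bar> \<le> M * e"
        using M[OF r] gP[OF r] M0 by (intro mult_mono) auto
      then show "g r * g r - g r * P (cos r) \<le> M * e"
        unfolding abs_mult[symmetric] by (simp add: algebra_simps)
    qed auto
    also have "\<dots> = e * (M * pi)" by simp
    finally show ?thesis .
  qed
  have "?J \<le> 0"
  proof (rule ccontr)
    assume n: "\<not> ?J \<le> 0"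
    \<comment> \<open>This \<open>e\<close> bounds a positive \<open>?J\<close> by its half; the
      summand 1 keeps the denominator positive when M = 0.\<close>
    define e where "e = ?J / (2 * (M * pi + 1))"
    have p: "M * pi + 1 > 0" using M0 by (intro add_nonneg_pos) auto
    have "e > 0" using n p by (simp add: e_def)
    have "?J \<le> e * (M * pi)" by (rule J) fact
    also have "\<dots> \<le> e * (M * pi + 1)" using \<open>e > 0\<close> by (intro mult_left_mono) auto
    also have "\<dots> = ?J / 2" using p by (simp add: e_def field_simps)
    finally show False using n by simp
  qed
  moreover have c2: "continuous_on {0..pi} (\<lambda>\<theta>. g \<theta> * g \<theta>)" by (intro continuous_intros g)
  then have "?J \<ge> 0" by (intro integral_nonneg integrable_continuous_real) auto
  ultimately have "?J = 0" by simp
  then have "\<forall>\<theta>\<in>{0..pi}. g \<theta> * g \<theta> = 0"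
    by (subst (asm) integral_eq_0_iff[OF c2]) auto
  then show ?thesis using \<theta> by simp
qed

text \<open>Differentiation under the integral sign, relative to \<open>U\<close> so that the
  endpoints of [-T,T] are included.\<close>

lemma cos_coefficient_deriv:
  fixes G G1 :: "real \<Rightarrow> real \<Rightarrow> real"
  assumes "\<And>t \<theta>. t \<in> U \<Longrightarrow> ((\<lambda>t. G t \<theta>) has_real_derivative G1 t \<theta>) (at t within U)"
    and "\<And>t. t \<in> U \<Longrightarrow> continuous_on {0..pi} (G t)"
    and G1: "continuous_on (U \<times> {0..pi}) (\<lambda>(t, \<theta>). G1 t \<theta>)"
    and U: "t \<in> U" "convex U"
  shows "((\<lambda>t. integral {0..pi} (\<lambda>\<theta>. G t \<theta> * cos (m * \<theta>))) has_real_derivative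
    integral {0..pi} (\<lambda>\<theta>. G1 t \<theta> * cos (m * \<theta>))) (at t within U)"
  unfolding box_real(2)[symmetric]
proof (rule leibniz_rule_field_derivative)
  show "(\<lambda>\<theta>. G t \<theta> * cos (m * \<theta>)) integrable_on cbox 0 pi" if "t \<in> U" for t
    unfolding box_real(2)
    by (intro integrable_continuous_real continuous_intros assms(2)[OF that])
  show "continuous_on (U \<times> cbox 0 pi) (\<lambda>(t, \<theta>). G1 t \<theta> * cos (m * \<theta>))"
    using G1 unfolding case_prod_unfold box_real(2) by (intro continuous_intros)
  show "((\<lambda>t. G t \<theta> * cos (m * \<theta>)) has_real_derivative G1 t \<theta> * cos (m * \<theta>)) (at t within U)"
    if "t \<in> U" for t \<theta>
    by (rule DERIV_cmult_right[OF assms(1)[OF that]])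
qed (use U in auto)

context delaunay_param
begin

section \<open>Decomposition of the degenerate set into modes\<close>

lemma continuous_on_dsn [continuous_intros]: "continuous_on S dsn"
  by (rule DERIV_continuous_on[OF has_field_derivative_at_within[OF dsn_deriv]])

text \<open>A mode is restricted to [-T,T]. Its second derivatives are products of a function of t
  and one of the angle; w'' = (j^2 - 2p) w is again differentiable, so \<open>holder_on_mult\<close>
  applies to each of them.\<close>

lemma degen_mode_subset_degen:
  assumes \<alpha>: "0 < \<alpha>" "\<alpha> < 1"
  shows "degen_mode a j \<subseteq> degen \<alpha> a"
proof
  fix T assume "T \<in> degen_mode a j"
  obtain w v where m: "mode_solution j w v" using mode_solution_exists by blast
  have T: "T > 0" "w T = 0" using \<open>T \<in> _\<close> unfolding degen_mode_eq[OF m] by auto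
  define \<phi> where "\<phi> = (\<lambda>t \<theta>. w t * cos (real j * \<theta>))"
  let ?g = "\<lambda>t. ((real j)\<^sup>2 - 2 * pot t) * w t"
  let ?g' = "\<lambda>t. ((real j)\<^sup>2 - 2 * pot t) * v t + (0 - 2 * (- 2 * b\<^sup>2 * sn t * dsn t)) * w t"
  have dg: "(?g has_real_derivative ?g' t) (at t within S)" for t S
    by (intro DERIV_mult' mode_solutionD[OF m] DERIV_diff DERIV_const DERIV_cmult
        has_field_derivative_at_within[OF pot_deriv])
  note cv = mode_continuous[OF m]
  \<comment> \<open>A single bound for all angular factors and their derivatives, whose coefficients
    are 1, j, j^2 and j^3.\<close>
  define B where "B = 1 + real j + (real j)\<^sup>2 + real j ^ 3"
  have d3: "((\<lambda>\<theta>. - ((real j)\<^sup>2 * cos (real j * \<theta>))) has_real_derivative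
      real j ^ 3 * sin (real j * \<theta>)) (at \<theta>)" for \<theta>
    by (rule derivative_eq_intros refl | simp add: power2_eq_square power3_eq_cube)+
  have Bb: "\<bar>k * sin x\<bar> \<le> B" "\<bar>k * cos x\<bar> \<le> B" if "0 \<le> k" "k \<le> B" for k x
    using that mult_mono[of k B "\<bar>sin x\<bar>" 1] mult_mono[of k B "\<bar>cos x\<bar>" 1]
    by (auto simp: abs_mult)
  have Bj: "1 \<le> B" "real j \<le> B" "(real j)\<^sup>2 \<le> B" "real j ^ 3 \<le> B"
    by (auto simp: B_def)
  have "C2_holder_cyl \<alpha> {-T..T} \<phi>"
    unfolding C2_holder_cyl_def \<phi>_def
  proof (intro conjI mode_second_derivs[OF m])
    show "holder_on \<alpha> ({-T..T} \<times> UNIV) (\<lambda>(t, \<theta>). ?g t * cos (real j * \<theta>))"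
      by (rule holder_on_mult[OF \<alpha> dg _ DERIV_cos_mult, where B=B])
         (use Bb(1)[OF _ Bj(2)] Bb(2)[OF _ Bj(1)] in \<open>auto intro!: continuous_intros cv\<close>)
    show "holder_on \<alpha> ({-T..T} \<times> UNIV) (\<lambda>(t, \<theta>). v t * - (real j * sin (real j * \<theta>)))"
      by (rule holder_on_mult[OF \<alpha> mode_solutionD(2)[OF m] _ DERIV_sin_mult, where B=B])
         (use Bb(1)[OF _ Bj(2)] Bb(2)[OF _ Bj(3)] in \<open>auto intro!: continuous_intros cv\<close>)
    show "holder_on \<alpha> ({-T..T} \<times> UNIV) (\<lambda>(t, \<theta>). w t * - ((real j)\<^sup>2 * cos (real j * \<theta>)))"
      by (rule holder_on_mult[OF \<alpha> mode_solutionD(1)[OF m] _ d3, where B=B])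
         (use Bb(2)[OF _ Bj(3)] Bb(1)[OF _ Bj(4)] in \<open>auto intro!: continuous_intros cv\<close>)
  qed (simp add: cos_periodic_nat)
  then have "\<phi> \<in> space_X \<alpha> T"
    using T mode_solution_even[OF m] by (simp add: space_X_def \<phi>_def)
  moreover have "\<phi> 0 0 \<noteq> 0" using mode_solutionD(3)[OF m] by (simp add: \<phi>_def)
  moreover have "jacobi_op a {-T..T} \<phi> t \<theta> = 0" if "t \<in> {-T..T}" for t \<theta>
    unfolding \<phi>_def
    by (rule mode_jacobi_op[OF m _ that]) (use T in \<open>simp add: trivial_limit_within\<close>)
  moreover have "0 \<in> {-T..T}" using T by simp
  ultimately show "T \<in> degen \<alpha> a"
    using T unfolding degen_def by blast
qed

text \<open>The Fourier coefficients are taken after symmetrizing about an angle \<open>\<theta>\<^sub>0\<close> at which the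
  function does not vanish; this way cosines suffice.\<close>

lemma degen_subset_degen_mode:
  assumes \<alpha>: "0 < \<alpha>"
  shows "degen \<alpha> a \<subseteq> (\<Union>j. degen_mode a j)"
proof
  fix T assume "T \<in> degen \<alpha> a"
  then obtain \<phi> t0 \<theta>0 where T: "T > 0" and X: "\<phi> \<in> space_X \<alpha> T"
    and t0: "t0 \<in> {-T..T}" and nz: "\<phi> t0 \<theta>0 \<noteq> 0"
    and J: "\<And>t \<theta>. t \<in> {-T..T} \<Longrightarrow> jacobi_op a {-T..T} \<phi> t \<theta> = 0"
    unfolding degen_def by blast
  define U where "U = {-T..T}"
  have per: "\<phi> t (\<theta> + 2 * pi) = \<phi> t \<theta>" if "t \<in> U" for t \<theta>
    using X that unfolding space_X_def C2_holder_cyl_def U_def by blast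
  have bd: "\<phi> T \<theta> = 0" for \<theta> using X unfolding space_X_def by blast
  have ev: "\<phi> (- t) \<theta> = \<phi> t \<theta>" if "t \<in> U" for t \<theta>
    using X that unfolding space_X_def U_def by (metis (mono_tags, lifting) mem_Collect_eq)
  have "second_derivs_on (U \<times> UNIV) (holder_on \<alpha> (U \<times> UNIV)) (\<lambda>(t, \<theta>). \<phi> t \<theta>)"
    using X unfolding space_X_def C2_holder_cyl_def U_def by blast
  then obtain F1 F2 F11 F12 F21 F22 where gr: "has_gradient_on (U \<times> UNIV) (\<lambda>(t, \<theta>). \<phi> t \<theta>) F1 F2"
      "has_gradient_on (U \<times> UNIV) F1 F11 F12" "has_gradient_on (U \<times> UNIV) F2 F21 F22"
    and ho: "holder_on \<alpha> (U \<times> UNIV) F11" "holder_on \<alpha> (U \<times> UNIV) F22"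
    unfolding second_derivs_on_def by blast
  have c: "(\<lambda>(t, \<theta>). f (t, \<theta>)) = f" for f :: "real \<times> real \<Rightarrow> real" by auto
  note s = has_gradient_on_slice[OF gr(1)]
    has_gradient_on_slice[where f="\<lambda>t \<theta>. F1 (t, \<theta>)", unfolded c, OF gr(2)]
    has_gradient_on_slice[where f="\<lambda>t \<theta>. F2 (t, \<theta>)", unfolded c, OF gr(3)]
  have cont: "continuous_on (U \<times> UNIV) F1" "continuous_on (U \<times> UNIV) F11" "continuous_on (U \<times> UNIV) F22"
    using holder_on_imp_continuous_on[OF \<alpha>] ho has_gradient_on_continuous_on[OF gr(2)] by auto
  have IU: "at t within U \<noteq> bot" if "t \<in> U" for t
    using that T by (simp add: U_def trivial_limit_within)
  have pde: "F11 (t, \<theta>) + F22 (t, \<theta>) = - 2 * pot t * \<phi> t \<theta>" if "t \<in> U" for t \<theta>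
    using jacobi_op_C2[OF IU gr that, of \<theta>] J[of t \<theta>] that prof_nz[of t] by (simp add: U_def)
  \<comment> \<open>Periodicity passes to the angular derivative; it removes the boundary term at
    angle pi in the integration by parts below.\<close>
  have per2: "F2 (t, \<theta> + 2 * pi) = F2 (t, \<theta>)" if t: "t \<in> U" for t \<theta>
  proof -
    have "((\<lambda>\<theta>. \<phi> t (\<theta> + 2 * pi)) has_real_derivative F2 (t, \<theta> + 2 * pi)) (at \<theta>)"
      using s(2)[OF t, of "\<theta> + 2 * pi"] by (simp add: DERIV_shift)
    then show ?thesis using s(2)[OF t, of \<theta>] by (simp add: per[OF t] DERIV_unique)
  qed
  define sym :: "(real \<Rightarrow> real \<Rightarrow> real) \<Rightarrow> real \<Rightarrow> real \<Rightarrow> real"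
    where "sym f t \<theta> = f t (\<theta>0 + \<theta>) + f t (\<theta>0 - \<theta>)" for f t \<theta>
  define G where "G = sym \<phi>"
  define G1 where "G1 = sym (\<lambda>t \<theta>. F1 (t, \<theta>))"
  define G11 where "G11 = sym (\<lambda>t \<theta>. F11 (t, \<theta>))"
  define G22 where "G22 = sym (\<lambda>t \<theta>. F22 (t, \<theta>))"
  define G2 where "G2 t \<theta> = F2 (t, \<theta>0 + \<theta>) - F2 (t, \<theta>0 - \<theta>)" for t \<theta>
  have dG: "((\<lambda>t. G t \<theta>) has_real_derivative G1 t \<theta>) (at t within U)"
    and dG1: "((\<lambda>t. G1 t \<theta>) has_real_derivative G11 t \<theta>) (at t within U)" if "t \<in> U" for t \<theta>
    unfolding G_def G1_def G11_def sym_def using s(1,3)[OF that] by (auto intro!: DERIV_add)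
  have dGh: "(G t has_real_derivative G2 t \<theta>) (at \<theta>)"
    and dG2h: "(G2 t has_real_derivative G22 t \<theta>) (at \<theta>)" if t: "t \<in> U" for t \<theta>
  proof -
    have p: "((\<lambda>\<theta>. \<theta>0 + \<theta>) has_real_derivative 1) (at \<theta>)"
      and n: "((\<lambda>\<theta>. \<theta>0 - \<theta>) has_real_derivative - 1) (at \<theta>)"
      by (rule derivative_eq_intros refl | simp)+
    show "(G t has_real_derivative G2 t \<theta>) (at \<theta>)"
      unfolding G_def G2_def sym_def[abs_def]
      using DERIV_add[OF DERIV_chain2[OF s(2)[OF t] p] DERIV_chain2[OF s(2)[OF t] n]] by simp
    show "(G2 t has_real_derivative G22 t \<theta>) (at \<theta>)"
      unfolding G2_def[abs_def] G22_def sym_def[abs_def]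
      using DERIV_diff[OF DERIV_chain2[OF s(6)[OF t] p] DERIV_chain2[OF s(6)[OF t] n]] by simp
  qed
  have cG: "continuous_on S (G t)" if "t \<in> U" for t S
    by (rule DERIV_continuous_on[OF has_field_derivative_at_within[OF dGh[OF that]]])
  have csym: "continuous_on (U \<times> S) (\<lambda>(t, \<theta>). sym (\<lambda>t \<theta>. F (t, \<theta>)) t \<theta>)"
    if "continuous_on (U \<times> UNIV) F" for F S
    unfolding sym_def case_prod_unfold
    by (intro continuous_on_add continuous_on_compose2[OF that]) (auto intro!: continuous_intros)
  have csym1: "continuous_on S (sym (\<lambda>t \<theta>. F (t, \<theta>)) t)" if "continuous_on (U \<times> UNIV) F" "t \<in> U" for F S t
    unfolding sym_def[abs_def] using that(2)
    by (intro continuous_on_add continuous_on_compose2[OF that(1)]) (auto intro!: continuous_intros)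
  define w1 where "w1 j t = integral {0..pi} (\<lambda>\<theta>. G t \<theta> * cos (real j * \<theta>))" for j :: nat and t
  define v1 where "v1 j t = integral {0..pi} (\<lambda>\<theta>. G1 t \<theta> * cos (real j * \<theta>))" for j :: nat and t
  \<comment> \<open>At angle 0 both terms of the symmetrization equal the nonzero value of \<phi> at
    (t0, \<theta>0), so by completeness of the cosines some coefficient survives at t0.\<close>
  have "G t0 0 \<noteq> 0" using nz by (simp add: G_def sym_def)
  then obtain j where j: "w1 j t0 \<noteq> 0"
    using cos_coefficients_zero[OF cG[of t0], of 0] t0 unfolding w1_def U_def by force
  have cU: "convex U" by (simp add: U_def)
  have dw: "(w1 j has_real_derivative v1 j t) (at t within U)" if "t \<in> U" for t
    unfolding w1_def[abs_def] v1_def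
    by (rule cos_coefficient_deriv[OF dG cG _ that cU])
       (use csym[OF cont(1), of "{0..pi}"] in \<open>simp_all add: G1_def\<close>)
  have dv: "(v1 j has_real_derivative ((real j)\<^sup>2 - 2 * pot t) * w1 j t) (at t within U)" if t: "t \<in> U" for t
  proof -
    have "(v1 j has_real_derivative integral {0..pi} (\<lambda>\<theta>. G11 t \<theta> * cos (real j * \<theta>))) (at t within U)"
      unfolding v1_def[abs_def]
      by (rule cos_coefficient_deriv[OF dG1 _ _ t cU])
         (use csym[OF cont(2), of "{0..pi}"] csym1[OF cont(1)] in \<open>simp_all add: G1_def G11_def\<close>)
    moreover have "integral {0..pi} (\<lambda>\<theta>. G11 t \<theta> * cos (real j * \<theta>)) =
        ((real j)\<^sup>2 - 2 * pot t) * w1 j t"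
    proof -
      \<comment> \<open>The boundary expression of two integrations by parts, which move the angular
        derivatives onto the cosine. It vanishes at 0 by symmetry about \<theta>0 and at pi because
        \<theta>0 + pi and \<theta>0 - pi differ by a full period.\<close>
      let ?H = "\<lambda>\<theta>. G2 t \<theta> * cos (real j * \<theta>) - G t \<theta> * - (real j * sin (real j * \<theta>))"
      have "((\<lambda>\<theta>. (G22 t \<theta> + (real j)\<^sup>2 * G t \<theta>) * cos (real j * \<theta>)) has_integral ?H pi - ?H 0) {0..pi}"
      proof (rule fundamental_theorem_of_calculus)
        fix r :: real
        have "(?H has_real_derivative (G2 t r * - (real j * sin (real j * r)) + G22 t r * cos (real j * r))
            - (G t r * - ((real j)\<^sup>2 * cos (real j * r)) + G2 t r * - (real j * sin (real j * r)))) (at r)"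
          by (intro DERIV_diff DERIV_mult' dGh[OF t] dG2h[OF t] DERIV_cos_mult DERIV_sin_mult)
        then have "(?H has_real_derivative (G22 t r + (real j)\<^sup>2 * G t r) * cos (real j * r)) (at r)"
          by (simp add: algebra_simps)
        then show "(?H has_vector_derivative (G22 t r + (real j)\<^sup>2 * G t r) * cos (real j * r))
            (at r within {0..pi})"
          unfolding has_real_derivative_iff_has_vector_derivative[symmetric]
          by (rule has_field_derivative_at_within)
      qed simp
      moreover have "?H 0 = 0" by (simp add: G2_def)
      moreover have "?H pi = 0"
      proof -
        have "sin (real j * pi) = 0" by simp
        moreover have "G2 t pi = 0" using per2[OF t, of "\<theta>0 - pi"] by (simp add: G2_def add.commute)
        ultimately show ?thesis by simp
      qed
      ultimately have I0: "integral {0..pi} (\<lambda>\<theta>. (G22 t \<theta> + (real j)\<^sup>2 * G t \<theta>) * cos (real j * \<theta>)) = 0"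
        by (simp add: integral_unique)
      have G11: "G11 t \<theta> * cos (real j * \<theta>) = ((real j)\<^sup>2 - 2 * pot t) * (G t \<theta> * cos (real j * \<theta>))
          - (G22 t \<theta> + (real j)\<^sup>2 * G t \<theta>) * cos (real j * \<theta>)" for \<theta>
      proof -
        have "G11 t \<theta> + G22 t \<theta> = - 2 * pot t * G t \<theta>"
          using pde[OF t, of "\<theta>0 + \<theta>"] pde[OF t, of "\<theta>0 - \<theta>"]
          by (simp add: G11_def G22_def G_def sym_def algebra_simps)
        then have eq: "G11 t \<theta> = - 2 * pot t * G t \<theta> - G22 t \<theta>" by linarith
        show ?thesis unfolding eq by (simp add: algebra_simps)
      qed
      have "integral {0..pi} (\<lambda>\<theta>. G11 t \<theta> * cos (real j * \<theta>)) =
          integral {0..pi} (\<lambda>\<theta>. ((real j)\<^sup>2 - 2 * pot t) * (G t \<theta> * cos (real j * \<theta>)))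
          - integral {0..pi} (\<lambda>\<theta>. (G22 t \<theta> + (real j)\<^sup>2 * G t \<theta>) * cos (real j * \<theta>))"
        unfolding G11
        by (intro integral_diff integrable_continuous_real continuous_intros cG[OF t])
           (use csym1[OF cont(3) t] in \<open>simp add: G22_def\<close>)
      then show ?thesis by (simp add: I0 w1_def)
    qed
    ultimately show ?thesis by simp
  qed
  \<comment> \<open>The coefficient inherits evenness in t from \<phi>. As 0 is an interior point,
    its derivative there is two-sided and must vanish.\<close>
  have v0: "v1 j 0 = 0"
  proof -
    have z: "0 \<in> {-T<..<T}" "0 \<in> U" using T by (auto simp: U_def)
    have "at 0 within U = at (0 :: real)"
      unfolding U_def by (rule at_within_Icc_at) (use T in auto)
    then have d: "(w1 j has_real_derivative v1 j 0) (at 0)" using dw[OF z(2)] by simp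
    have "((\<lambda>t. w1 j (- t)) has_real_derivative - v1 j 0) (at 0)"
      using d DERIV_mirror[where f="w1 j" and x=0 and y="v1 j 0"] by simp
    then have "(w1 j has_real_derivative - v1 j 0) (at 0)"
    proof (rule has_field_derivative_transform_within_open[of _ _ _ "{-T<..<T}"])
      show "w1 j (- t) = w1 j t" if "t \<in> {-T<..<T}" for t
        using ev[of t] that unfolding w1_def G_def sym_def by (simp add: U_def)
    qed (use z in auto)
    from DERIV_unique[OF this d] show ?thesis by simp
  qed
  obtain w v where m: "mode_solution j w v" using mode_solution_exists by blast
  have eq: "w1 j t = w1 j 0 * w t" if "t \<in> U" for t
    by (rule mode_solution_unique[OF m, where u="w1 j" and u'="v1 j" and T=T])
       (use dw dv v0 that in \<open>simp_all only: U_def\<close>)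
  have "w1 j 0 \<noteq> 0" using eq[of t0] j t0 by (auto simp: U_def)
  moreover have "w1 j T = 0" using bd by (simp add: w1_def G_def sym_def)
  ultimately have "w T = 0" using eq[of T] T by (simp add: U_def)
  then show "T \<in> (\<Union>j. degen_mode a j)"
    using T degen_mode_eq[OF m] by blast
qed

lemma degen_eq:
  assumes "0 < \<alpha>" "\<alpha> < 1"
  shows "degen \<alpha> a = (\<Union>j. degen_mode a j)"
  using degen_mode_subset_degen[OF assms] degen_subset_degen_mode[OF assms(1)] by blast

text \<open>A common point would satisfy k < l + 1/2 < k + 1/2 with integers k and l: the zeros of
  mode 0 lie strictly inside the first halves of the intervals, those of mode 1 at
  midpoints.\<close>

lemma degen_mode_0_1_disjoint:
  assumes "a > 0"
  shows "degen_mode a 0 \<inter> degen_mode a 1 = {}"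
proof -
  have b: "b \<noteq> 0" using assms by (simp add: b_def)
  obtain T :: "nat \<Rightarrow> real" where T: "degen_mode a 0 = range T"
    "\<And>k. T k \<in> {real k * tau<..<(real k + 1/2) * tau}"
    using degen_mode_0 b by blast
  have False if "T k = (real l + 1/2) * tau" for k l :: nat
  proof -
    have "real k < real l + 1/2" "real l + 1/2 < real k + 1/2"
      using T(2)[of k] tau_pos unfolding that by (auto simp: mult_less_cancel_right)
    then have "l < k" by simp
    then have "real (Suc l) \<le> real k" by (simp only: of_nat_le_iff Suc_le_eq)
    then show False using \<open>real k < real l + 1/2\<close> by simp
  qed
  then show ?thesis unfolding T(1) degen_mode_1[OF assms] by blast
qed

end

theorem theorem1p1:
  fixes \<alpha> :: real
  assumes "0 < \<alpha>" and "\<alpha> < 1"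
  shows
    "(\<forall>a \<in> {-1<..<0} \<union> {0<..}. degen \<alpha> a = (\<Union>j. degen_mode a j)) \<and>
     (\<forall>a \<in> {-1<..<0} \<union> {0<..}. \<exists>T :: nat \<Rightarrow> real.
        strict_mono T \<and> degen_mode a 0 = range T \<and>
        (a \<noteq> -1/2 \<longrightarrow>
          (\<forall>k. T k \<in> {real k * delaunay_tau a <..< (real k + 1/2) * delaunay_tau a}))) \<and>
     (\<forall>a \<in> {-1<..<0}. (\<forall>j\<ge>1. degen_mode a j = {}) \<and> degen \<alpha> a = degen_mode a 0) \<and>
     (\<forall>a>0. degen_mode a 1 = range (\<lambda>k::nat. (real k + 1/2) * delaunay_tau a) \<and>
        degen_mode a 0 \<inter> degen_mode a 1 = {}) \<and>
     (\<forall>a \<in> {0<..(sqrt 3 - 1) / 2}. (\<forall>j\<ge>2. degen_mode a j = {}) \<and>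
        degen \<alpha> a = degen_mode a 0 \<union> degen_mode a 1) \<and>
     (\<forall>j\<ge>2. \<exists>a'>0. \<forall>a\<ge>a'. degen_mode a j \<noteq> {})"
proof -
  have param: "delaunay_param a" if "a \<in> {-1<..<0} \<union> {0<..}" for a
    using that by unfold_locales auto
  have b: "delaunay_param.b a = 1 + 2 * a" if "a \<in> {-1<..<0} \<union> {0<..}" for a
    using delaunay_param.b_def[OF param[OF that]] .
  have eq: "degen \<alpha> a = (\<Union>j. degen_mode a j)" if "a \<in> {-1<..<0} \<union> {0<..}" for a
    using delaunay_param.degen_eq[OF param[OF that] assms] .
  have i: "\<exists>T :: nat \<Rightarrow> real. strict_mono T \<and> degen_mode a 0 = range T \<and>
        (a \<noteq> -1/2 \<longrightarrow>
          (\<forall>k. T k \<in> {real k * delaunay_tau a <..< (real k + 1/2) * delaunay_tau a}))"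
    if a: "a \<in> {-1<..<0} \<union> {0<..}" for a
  proof -
    have "a \<noteq> -1/2 \<Longrightarrow> delaunay_param.b a \<noteq> 0" unfolding b[OF a] by simp
    then show ?thesis
      using delaunay_param.degen_mode_0[OF param[OF a]]
      unfolding delaunay_param.delaunay_tau_eq[OF param[OF a]] by blast
  qed
  have ii: "\<forall>j\<ge>1. degen_mode a j = {}" if "a \<in> {-1<..<0}" for a
    using delaunay_param.degen_mode_empty_neg[OF param] that by auto
  have ii': "degen \<alpha> a = degen_mode a 0" if a: "a \<in> {-1<..<0}" for a
  proof -
    have "degen_mode a j \<subseteq> degen_mode a 0" for j
      using ii[OF a] by (cases "j = 0") auto
    then show ?thesis using eq[of a] a by blast
  qed
  have iii: "degen_mode a 1 = range (\<lambda>k::nat. (real k + 1/2) * delaunay_tau a) \<and>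
        degen_mode a 0 \<inter> degen_mode a 1 = {}" if "a > 0" for a
    using delaunay_param.degen_mode_1[OF param that] delaunay_param.degen_mode_0_1_disjoint[OF param that]
      delaunay_param.delaunay_tau_eq[OF param] that by simp
  have iv: "\<forall>j\<ge>2. degen_mode a j = {}" if a: "a \<in> {0<..(sqrt 3 - 1) / 2}" for a
  proof (intro allI impI)
    fix j :: nat assume "j \<ge> 2"
    \<comment> \<open>The bound gives a <= 1/2, hence b = 1 + 2a <= 2 <= j, so that the comparison
      with \<open>kap\<close> applies.\<close>
    have "sqrt 3 \<le> 2" by (rule real_le_lsqrt) auto
    then have "delaunay_param.b a \<le> real j" using \<open>j \<ge> 2\<close> a by (subst b) (auto simp: field_simps)
    then show "degen_mode a j = {}"
      using delaunay_param.degen_mode_empty_pos[OF param] a by simp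
  qed
  have iv': "degen \<alpha> a = degen_mode a 0 \<union> degen_mode a 1" if a: "a \<in> {0<..(sqrt 3 - 1) / 2}" for a
  proof -
    have "degen_mode a j \<subseteq> degen_mode a 0 \<union> degen_mode a 1" for j
    proof (cases "j \<ge> 2")
      case False
      then have "j = 0 \<or> j = 1" by auto
      then show ?thesis by auto
    qed (use iv[OF a] in auto)
    then have "(\<Union>j. degen_mode a j) = degen_mode a 0 \<union> degen_mode a 1"
      by (intro equalityI UN_least Un_least UN_upper UNIV_I)
    then show ?thesis using eq[of a] a by simp
  qed
  have v: "\<exists>a'>0. \<forall>a\<ge>a'. degen_mode a j \<noteq> {}" for j :: nat
  \<comment> \<open>The threshold only has to guarantee j < 1 + 2a.\<close>
  proof (intro exI[of _ "real j + 1"] conjI allI impI)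
    fix a assume a: "real j + 1 \<le> a"
    then have "a > 0" by linarith
    then show "degen_mode a j \<noteq> {}"
      using delaunay_param.degen_mode_nonempty[OF param, of a j] b[of a] a by simp
  qed simp
  show ?thesis
    by (rule conjI[OF _ conjI[OF _ conjI[OF _ conjI[OF _ conjI]]]])
       (rule eq i ii ii' iii iv iv' v ballI allI impI conjI | assumption)+
qed

end
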